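(* Assume $S_p^{\mu}$ is self-adjoint. Let $\lambda\in\sigma(S_p^{\mu})$, and assume that there exist a real number $r_\lambda>0$, a sequence $\{\lambda_N\}$ with $\lambda_N\in\sigma(S_{p,N}^{\mu})$, and a positive integer $N_0$ such that for every $N>N_0$ $$|\lambda-\lambda_N|\le \frac{r_\lambda}{2}\quad\text{and}\quad 2r_\lambda\le \min\left\{\mathrm{dist}(\lambda,\sigma(S_p^{\mu})\setminus\{\lambda\}),\ \mathrm{dist}(\lambda,\sigma(S_{p,N}^{\mu})\setminus\{\lambda_N\})\right\}.$$ Let $\phi$ be an eigenvector of $S_p^\mu$ corresponding to $\lambda$. (i) If the coefficients $f_0,\dots,f_{p-1}$ are $C^\infty$, then for every positive integer $q$ there exists a positive constant $C_1$, depending only on $p$, $f_0,\dots,f_{p-1}$, $\lambda$, $r_\lambda$, $q$ and $\phi$, such that for all sufficiently large $N$ $$|\lambda-\lambda_N|\le C_1 N^{-q}.$$ (ii) If, for some $d>0$, the coefficients $f_0,\dots,f_{p-1}$ are analytic on $\mathcal{D}_d=\{z\in\mathbf{C} : |\mathrm{Im}\,z|<d\}$, then for every $\varepsilon$ with $0<\varepsilon<d$ there exists a positive constant $C_2$, depending only on $p$, $f_0,\dots,f_{p-1}$, $\lambda$, $r_\lambda$, $d$, $\varepsilon$ and $\phi$, such that for all sufficiently large $N$ $$|\lambda-\lambda_N|\le C_2 N^{p+1/2}\exp\left(-\frac{2\pi(d-\varepsilon)}{L}N\right).$$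
   Context: Let $p$ be a positive integer and $L>0$. Let $S_p=\frac{d^p}{dx^p}+\sum_{j=0}^{p-1}\tilde f_j(x)\frac{d^j}{dx^j}$ on $\mathbf{R}$, where the $\tilde f_j$ are $C^\infty$ and $L$-periodic. For $\mu\in[0,2\pi/L)$ put $S_p^{\mu}=e^{-i\mu x}S_pe^{i\mu x}=\frac{d^p}{dx^p}+\sum_{j=0}^{p-1}f_j(x)\frac{d^j}{dx^j}$, where the $f_j$ are the resulting $L$-periodic coefficients; $S_p^\mu$ is regarded as an operator $H^p([0,L])_{\mathrm{per}}\to L_2([0,L])_{\mathrm{per}}$ (an unbounded operator in $L_2([0,L])_{\mathrm{per}}$ with domain $H^p([0,L])_{\mathrm{per}}$), where $L_2([0,L])_{\mathrm{per}}$ and $H^p([0,L])_{\mathrm{per}}$ are the Lebesgue and Sobolev spaces of periodic functions on $[0,L]$. Its spectrum is $\sigma(S_p^\mu)$, which consists of eigenvalues only. For a positive integer $N$, $\hat P_N$ is the Fourier truncation $\hat P_N\phi=\sum_{n=-N}^N\hat\phi_n e_n$, with $e_n(x)=\frac{1}{\sqrt L}\exp(-i\frac{2\pi n x}{L})$ and $\hat\phi_n=(\phi,e_n)_2$. Put $S_{p,N}^\mu=\hat P_NS_p^\mu\hat P_N$. The set $\sigma(S_{p,N}^\mu)$ denotes the set of eigenvalues of $S_{p,N}^\mu$ in the finite-dimensional (matrix) eigenvalue problem $S_{p,N}^\mu\phi_N=\lambda_N\phi_N$ with $\phi_N\ne 0$ in the $(2N+1)$-dimensional range of $\hat P_N$.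 $\mathrm{dist}(z,A)=\inf_{a\in A}|z-a|$. *)

theory Defs
  imports "HOL-Complex_Analysis.Complex_Analysis"
begin

section \<open>Smooth functions and differential expressions\<close>

definition nth_deriv :: "nat \<Rightarrow> (real \<Rightarrow> complex) \<Rightarrow> real \<Rightarrow> complex" where
  "nth_deriv n u = ((\<lambda>g x. vector_derivative g (at x)) ^^ n) u"

definition smooth :: "(real \<Rightarrow> complex) \<Rightarrow> bool" where
  "smooth u \<longleftrightarrow> (\<forall>n x. nth_deriv n u differentiable (at x))"

definition periodic :: "real \<Rightarrow> (real \<Rightarrow> complex) \<Rightarrow> bool" where
  "periodic L u \<longleftrightarrow> (\<forall>x. u (x + L) = u x)"

definition diff_expr ::
  "nat \<Rightarrow> (nat \<Rightarrow> real \<Rightarrow> complex) \<Rightarrow> (real \<Rightarrow> complex) \<Rightarrow> real \<Rightarrow> complex" where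
  "diff_expr p c u x = nth_deriv p u x + (\<Sum>j<p. c j x * nth_deriv j u x)"

text \<open>
  The coefficients \<open>f\<close> are those of \<open>exp (-i \<mu> x) S exp (i \<mu> x)\<close>, where \<open>S\<close> has the coefficients
  \<open>ft\<close>. Testing against all smooth functions determines \<open>f j\<close> for every \<open>j < p\<close>.
\<close>
definition conjugated_coeffs ::
  "nat \<Rightarrow> real \<Rightarrow> (nat \<Rightarrow> real \<Rightarrow> complex) \<Rightarrow> (nat \<Rightarrow> real \<Rightarrow> complex) \<Rightarrow> bool" where
  "conjugated_coeffs p \<mu> ft f \<longleftrightarrow>
     (\<forall>u. smooth u \<longrightarrow>
        (\<forall>x. exp (- (\<i> * of_real (\<mu> * x))) *
               diff_expr p ft (\<lambda>y. exp (\<i> * of_real (\<mu> * y)) * u y) x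
             = diff_expr p f u x))"

definition analytic_on_strip :: "real \<Rightarrow> (real \<Rightarrow> complex) \<Rightarrow> bool" where
  "analytic_on_strip d g \<longleftrightarrow>
     (\<exists>G. G holomorphic_on {z. \<bar>Im z\<bar> < d} \<and> (\<forall>x. G (of_real x) = g x))"


section \<open>Periodic Lebesgue and Sobolev spaces\<close>

text \<open>
  Elements of the function spaces are represented by periodic functions; the identification of
  functions that agree almost everywhere is made explicit through \<open>ae_eq\<close>.
\<close>

definition L2_per :: "real \<Rightarrow> (real \<Rightarrow> complex) set" where
  "L2_per L = {u. periodic L u \<and> u \<in> borel_measurable (lebesgue_on {0..L}) \<and>
                  integrable (lebesgue_on {0..L}) (\<lambda>x. (cmod (u x))\<^sup>2)}"

definition ae_eq :: "real \<Rightarrow> (real \<Rightarrow> complex) \<Rightarrow> (real \<Rightarrow> complex) \<Rightarrow> bool" where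
  "ae_eq L u v \<longleftrightarrow> (AE x in lebesgue_on {0..L}. u x = v x)"

definition inner_L2 :: "real \<Rightarrow> (real \<Rightarrow> complex) \<Rightarrow> (real \<Rightarrow> complex) \<Rightarrow> complex" where
  "inner_L2 L u v = integral\<^sup>L (lebesgue_on {0..L}) (\<lambda>x. u x * cnj (v x))"

definition norm_L2 :: "real \<Rightarrow> (real \<Rightarrow> complex) \<Rightarrow> real" where
  "norm_L2 L u = sqrt (integral\<^sup>L (lebesgue_on {0..L}) (\<lambda>x. (cmod (u x))\<^sup>2))"

text \<open>
  The test functions are periodic rather than compactly supported in the open interval, so that a
  weak derivative on \<open>[0,L]\<close> also respects the periodic boundary condition.
\<close>
definition weak_deriv :: "real \<Rightarrow> nat \<Rightarrow> (real \<Rightarrow> complex) \<Rightarrow> (real \<Rightarrow> complex) \<Rightarrow> bool" where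
  "weak_deriv L j u g \<longleftrightarrow>
     (\<forall>\<psi>. smooth \<psi> \<and> periodic L \<psi> \<longrightarrow>
        integral\<^sup>L (lebesgue_on {0..L}) (\<lambda>x. u x * nth_deriv j \<psi> x) =
        (-1) ^ j * integral\<^sup>L (lebesgue_on {0..L}) (\<lambda>x. g x * \<psi> x))"

definition sobolev_per :: "real \<Rightarrow> nat \<Rightarrow> (real \<Rightarrow> complex) set" where
  "sobolev_per L p = {u \<in> L2_per L. \<forall>j\<le>p. \<exists>g\<in>L2_per L. weak_deriv L j u g}"

text \<open>A representative; weak derivatives are unique up to \<open>ae_eq\<close>.\<close>
definition wderiv :: "real \<Rightarrow> nat \<Rightarrow> (real \<Rightarrow> complex) \<Rightarrow> real \<Rightarrow> complex" where
  "wderiv L j u = (SOME g. g \<in> L2_per L \<and> weak_deriv L j u g)"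

text \<open>The operator with domain \<open>sobolev_per L p\<close>; its values elsewhere are irrelevant.\<close>
definition hill_op ::
  "real \<Rightarrow> nat \<Rightarrow> (nat \<Rightarrow> real \<Rightarrow> complex) \<Rightarrow> (real \<Rightarrow> complex) \<Rightarrow> real \<Rightarrow> complex" where
  "hill_op L p f u = (\<lambda>x. wderiv L p u x + (\<Sum>j<p. f j x * wderiv L j u x))"


section \<open>Unbounded operators \<open>T\<close> with domain \<open>D\<close>\<close>

text \<open>
  The graph of \<open>T\<close> equals that of its adjoint. This forces \<open>D\<close> to be dense: if \<open>v\<close> is orthogonal
  to \<open>D\<close>, then \<open>(0, v)\<close> lies in the graph of the adjoint, hence in that of \<open>T\<close>.
\<close>
definition selfadjoint_op ::
  "real \<Rightarrow> (real \<Rightarrow> complex) set \<Rightarrow> ((real \<Rightarrow> complex) \<Rightarrow> real \<Rightarrow> complex) \<Rightarrow> bool" where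
  "selfadjoint_op L D T \<longleftrightarrow>
     (\<forall>v\<in>L2_per L. \<forall>w\<in>L2_per L.
        (\<forall>u\<in>D. inner_L2 L (T u) v = inner_L2 L u w) \<longleftrightarrow> (v \<in> D \<and> ae_eq L (T v) w))"

text \<open>
  \<open>T - z\<close> is a bijection of \<open>D\<close> onto \<open>L2_per L\<close> with bounded inverse; the bound entails injectivity.
\<close>
definition resolvent_set_op ::
  "real \<Rightarrow> (real \<Rightarrow> complex) set \<Rightarrow> ((real \<Rightarrow> complex) \<Rightarrow> real \<Rightarrow> complex) \<Rightarrow> complex set" where
  "resolvent_set_op L D T =
     {z. (\<forall>g\<in>L2_per L. \<exists>u\<in>D. ae_eq L (\<lambda>x. T u x - z * u x) g) \<and>
         (\<exists>C. \<forall>u\<in>D. norm_L2 L u \<le> C * norm_L2 L (\<lambda>x. T u x - z * u x))}"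

definition spectrum_op ::
  "real \<Rightarrow> (real \<Rightarrow> complex) set \<Rightarrow> ((real \<Rightarrow> complex) \<Rightarrow> real \<Rightarrow> complex) \<Rightarrow> complex set" where
  "spectrum_op L D T = - resolvent_set_op L D T"

definition eigenvector_op ::
  "real \<Rightarrow> (real \<Rightarrow> complex) set \<Rightarrow> ((real \<Rightarrow> complex) \<Rightarrow> real \<Rightarrow> complex) \<Rightarrow>
   complex \<Rightarrow> (real \<Rightarrow> complex) \<Rightarrow> bool" where
  "eigenvector_op L D T z u \<longleftrightarrow>
     u \<in> D \<and> \<not> ae_eq L u (\<lambda>_. 0) \<and> ae_eq L (T u) (\<lambda>x. z * u x)"


section \<open>Fourier truncation\<close>

definition fourier_basis :: "real \<Rightarrow> int \<Rightarrow> real \<Rightarrow> complex" where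
  "fourier_basis L n x =
     of_real (1 / sqrt L) * exp (- (\<i> * of_real (2 * pi * of_int n * x / L)))"

definition fourier_trunc :: "real \<Rightarrow> nat \<Rightarrow> (real \<Rightarrow> complex) \<Rightarrow> real \<Rightarrow> complex" where
  "fourier_trunc L N u =
     (\<lambda>x. \<Sum>n = - int N..int N. inner_L2 L u (fourier_basis L n) * fourier_basis L n x)"

definition hill_trunc ::
  "real \<Rightarrow> nat \<Rightarrow> (nat \<Rightarrow> real \<Rightarrow> complex) \<Rightarrow> nat \<Rightarrow> (real \<Rightarrow> complex) \<Rightarrow> real \<Rightarrow> complex" where
  "hill_trunc L p f N u = fourier_trunc L N (hill_op L p f (fourier_trunc L N u))"

text \<open>Elements of the range are trigonometric polynomials, so they are compared pointwise.\<close>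
definition spectrum_trunc ::
  "real \<Rightarrow> nat \<Rightarrow> (nat \<Rightarrow> real \<Rightarrow> complex) \<Rightarrow> nat \<Rightarrow> complex set" where
  "spectrum_trunc L p f N =
     {z. \<exists>u \<in> fourier_trunc L N ` L2_per L.
           u \<noteq> (\<lambda>_. 0) \<and> hill_trunc L p f N u = (\<lambda>x. z * u x)}"

abbreviation spectrum_hill :: "real \<Rightarrow> nat \<Rightarrow> (nat \<Rightarrow> real \<Rightarrow> complex) \<Rightarrow> complex set" where
  "spectrum_hill L p f \<equiv> spectrum_op L (sobolev_per L p) (hill_op L p f)"

text \<open>Extended real, so that the distance to the empty set is infinite (\<open>infdist\<close> would give 0).\<close>
definition edist_set :: "complex \<Rightarrow> complex set \<Rightarrow> ereal" where
  "edist_set z A = (INF a\<in>A. ereal (cmod (z - a)))"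

definition separated_approximation ::
  "real \<Rightarrow> nat \<Rightarrow> (nat \<Rightarrow> real \<Rightarrow> complex) \<Rightarrow> complex \<Rightarrow> real \<Rightarrow> (nat \<Rightarrow> complex) \<Rightarrow> nat \<Rightarrow> bool" where
  "separated_approximation L p f lam r lamN N0 \<longleftrightarrow>
     (\<forall>N\<ge>1. lamN N \<in> spectrum_trunc L p f N) \<and> N0 \<ge> 1 \<and>
     (\<forall>N>N0. cmod (lam - lamN N) \<le> r / 2 \<and>
        ereal (2 * r) \<le> min (edist_set lam (spectrum_hill L p f - {lam}))
                            (edist_set lam (spectrum_trunc L p f N - {lamN N})))"

end

theory Submission
  imports Defs
begin

text \<open>
  Write \<open>E\<^sub>n(x) = exp (-2 \<pi> i n x / L)\<close>. On Fourier coefficients the operator is an infinite matrix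
  \<open>A\<close>: a diagonal part coming from the leading derivative, plus a convolution with the Fourier
  coefficients of the \<open>f\<^sub>j\<close> applied to the coefficients of the derivatives of order \<open>j < p\<close>. The
  truncated operator is the block \<open>A\<^sub>N\<close> of \<open>A\<close> with indices in \<open>{-N..N}\<close>. Self-adjointness
  of the operator makes \<open>A\<^sub>N\<close> Hermitian and the eigenvalue \<open>\<lambda>\<close> real.

  A Hermitian matrix has an eigenvalue within \<open>|(A\<^sub>N - \<lambda>) x| / |x|\<close> of \<open>\<lambda>\<close>, for every nonzero
  vector \<open>x\<close> (\<open>hermitian_eigenvalue_bound\<close>). The separation hypothesis forces \<open>\<lambda>\<^sub>N\<close> to be at least
  as close to \<open>\<lambda>\<close> as any other eigenvalue of \<open>A\<^sub>N\<close>. So \<open>|\<lambda> - \<lambda>\<^sub>N|\<close> is at most the residual that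
  the truncated coefficient vector of the eigenfunction leaves, divided by its norm. The norm stays away
  from \<open>0\<close>, because a nonzero integrable function has a nonzero Fourier coefficient
  (\<open>fourier_complete\<close>). Since \<open>A \<phi> = \<lambda> \<phi>\<close>, the residual is the contribution of the modes
  \<open>|n| > N\<close> that were cut off, and it is as small as the high Fourier coefficients of \<open>\<phi>\<close>
  (\<open>galerkin_residual\<close>).

  Their decay is obtained without regularity theory for differential equations. Let \<open>a\<^sub>n\<close> be the
  sum over \<open>j < p\<close> of the absolute \<open>n\<close>-th Fourier coefficients of the \<open>j\<close>-th derivative of \<open>\<phi>\<close>.
  The eigenvalue equation, solved for its leading term, gives
  \<open>|n| a\<^sub>n \<le> const (a\<^sub>n + \<Sum>\<^sub>m b\<^sub>n\<^sub>-\<^sub>m a\<^sub>m)\<close>, with \<open>b\<close> bounding the coefficients of the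
  \<open>f\<^sub>j\<close>. The factor \<open>|n|\<close> gained on the left lets the sequence \<open>a\<close> inherit every submultiplicative
  weight \<open>v\<close> for which \<open>b v\<close> is summable (\<open>convolution_bootstrap\<close>). Thus the error is
  \<open>O(sqrt N / v N)\<close> (\<open>galerkin_eigenvalue_rate\<close>). For smooth \<open>f\<^sub>j\<close> the weight is
  any power of \<open>1 + k\<close>, by integration by parts. For \<open>f\<^sub>j\<close> analytic in the strip of half-width \<open>d\<close>
  it is \<open>exp (2 \<pi> (d - \<epsilon>) k / L)\<close>, by shifting the contour of integration to \<open>Im z = \<plusminus>(d - \<epsilon>/2)\<close>.
\<close>

section \<open>Completeness of the Fourier system\<close>

definition fchar :: "real \<Rightarrow> int \<Rightarrow> real \<Rightarrow> complex" where
  "fchar L n x = cis (- (2 * pi * of_int n * x / L))"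

text \<open>
  The coefficients are left unnormalised: the Fourier series of \<open>u\<close> is
  \<open>\<Sum>\<^sub>n fcoeff L u n / L * fchar L n x\<close>.
\<close>
definition fcoeff :: "real \<Rightarrow> (real \<Rightarrow> complex) \<Rightarrow> int \<Rightarrow> complex" where
  "fcoeff L u n = integral\<^sup>L (lebesgue_on {0..L}) (\<lambda>x. u x * fchar L (- n) x)"

lemma fcoeff_cmult: "fcoeff L (\<lambda>x. c * u x) n = c * fcoeff L u n"
  by (simp add: fcoeff_def mult.assoc)

lemma fchar_add: "fchar L m x * fchar L n x = fchar L (m + n) x"
  by (simp add: fchar_def cis_mult algebra_simps add_divide_distrib)

lemma fchar_0 [simp]: "fchar L 0 x = 1"
  by (simp add: fchar_def)

lemma norm_fchar [simp]: "cmod (fchar L n x) = 1"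
  by (simp add: fchar_def)

lemma cnj_fchar: "cnj (fchar L n x) = fchar L (- n) x"
  by (simp add: fchar_def cis_cnj)

lemma continuous_fchar [continuous_intros]: "continuous_on S (fchar L n)"
  by (cases "L = 0") (auto simp: fchar_def intro!: continuous_intros)

lemma continuous_on_imp_measurable_lebesgue_on:
  fixes f :: "real \<Rightarrow> 'a::euclidean_space"
  assumes "continuous_on UNIV f"
  shows "f \<in> borel_measurable (lebesgue_on {a..b})"
  by (rule continuous_imp_measurable_on_sets_lebesgue)
    (use assms continuous_on_subset in auto)

lemma integrable_mult_bounded_on_period:
  fixes u h :: "real \<Rightarrow> complex"
  assumes u: "integrable (lebesgue_on {0..L}) u"
    and h: "h \<in> borel_measurable (lebesgue_on {0..L})"
    and B: "\<And>x. x \<in> {0..L} \<Longrightarrow> cmod (h x) \<le> B"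
  shows "integrable (lebesgue_on {0..L}) (\<lambda>x. u x * h x)"
proof (rule Bochner_Integration.integrable_bound)
  show "integrable (lebesgue_on {0..L}) (\<lambda>x. B * cmod (u x))"
    using u by auto
  show "(\<lambda>x. u x * h x) \<in> borel_measurable (lebesgue_on {0..L})"
    using u h by measurable
  show "AE x in lebesgue_on {0..L}. cmod (u x * h x) \<le> norm (B * cmod (u x))"
  proof (rule AE_I2)
    fix x assume "x \<in> space (lebesgue_on {0..L})"
    then have "cmod (h x) \<le> B" using B by simp
    then show "cmod (u x * h x) \<le> norm (B * cmod (u x))"
      by (simp add: norm_mult abs_mult mult.commute[of B])
         (metis abs_ge_self dual_order.trans mult_left_mono norm_ge_zero)
  qed
qed

lemma integrable_mult_fchar:
  assumes "integrable (lebesgue_on {0..L}) u"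
  shows "integrable (lebesgue_on {0..L}) (\<lambda>x. u x * fchar L n x)"
  by (rule integrable_mult_bounded_on_period[OF assms, where B = 1])
    (auto intro: continuous_on_imp_measurable_lebesgue_on continuous_intros)

text \<open>
  The parametrisation of the unit circle by \<open>[0,L]\<close>. Functions on the circle automatically
  match at the two ends of the period, which makes the Stone-Weierstrass theorem applicable.
\<close>
definition circle_point :: "real \<Rightarrow> real \<Rightarrow> complex" where
  "circle_point L x = fchar L (-1) x"

text \<open>
  The real and imaginary parts of a point of the circle are combinations of \<open>fchar L (-1)\<close> and
  \<open>fchar L 1\<close>, and multiplication by these only shifts Fourier coefficients. So the integrable
  functions without Fourier coefficients are closed under multiplication by any polynomial in the circle point.
\<close>
lemma real_polynomial_orthogonal:
  assumes q: "real_polynomial_function q"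
  shows "integrable (lebesgue_on {0..L}) w \<Longrightarrow> (\<And>n. fcoeff L w n = 0) \<Longrightarrow>
    integrable (lebesgue_on {0..L}) (\<lambda>x. w x * of_real (q (circle_point L x))) \<and>
    (\<forall>n. fcoeff L (\<lambda>x. w x * of_real (q (circle_point L x))) n = 0)"
  using q
proof (induction q arbitrary: w rule: real_polynomial_function.induct)
  case (linear f)
  define a where "a = (of_real (f 1) - \<i> * of_real (f \<i>)) / 2"
  define b where "b = (of_real (f 1) + \<i> * of_real (f \<i>)) / 2"
  have f: "of_real (f z) = a * z + b * cnj z" for z
  proof -
    have "f z = f (Re z *\<^sub>R 1 + Im z *\<^sub>R \<i>)"
      by (intro arg_cong[where f = f]) (simp add: complex_eq_iff)
    also have "\<dots> = Re z * f 1 + Im z * f \<i>"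
      using linear(1) by (simp add: linear_add linear_scale bounded_linear.linear)
    finally show ?thesis
      by (simp add: a_def b_def complex_eq_iff field_simps)
  qed
  have eq: "w x * of_real (f (circle_point L x)) * fchar L n x
      = a * (w x * fchar L (n - 1) x) + b * (w x * fchar L (n + 1) x)" for x n
    using fchar_add[of L "-1" x n] fchar_add[of L 1 x n]
    by (simp add: f circle_point_def cnj_fchar algebra_simps)
  have int: "integrable (lebesgue_on {0..L}) (\<lambda>x. w x * of_real (f (circle_point L x)) * fchar L n x)" for n
    unfolding eq by (intro Bochner_Integration.integrable_add integrable_mult_right
        integrable_mult_fchar linear)
  have "fcoeff L (\<lambda>x. w x * of_real (f (circle_point L x))) n = a * fcoeff L w (n + 1) + b * fcoeff L w (n - 1)" for n
  proof -
    have "- (n + 1) = - n - 1" "- (n - 1) = - n + 1" by auto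
    then show ?thesis unfolding fcoeff_def eq
      by (subst Bochner_Integration.integral_add)
        (auto intro!: integrable_mult_right integrable_mult_fchar linear)
  qed
  then show ?case using linear int[of 0] by simp
next
  case (const c)
  then show ?case by (simp add: fcoeff_cmult mult.commute[of _ "complex_of_real c"])
next
  case (add f g)
  have i: "integrable (lebesgue_on {0..L}) (\<lambda>x. w x * of_real (f (circle_point L x)))"
    "integrable (lebesgue_on {0..L}) (\<lambda>x. w x * of_real (g (circle_point L x)))"
    using add by auto
  have "fcoeff L (\<lambda>x. w x * of_real (f (circle_point L x) + g (circle_point L x))) n =
     fcoeff L (\<lambda>x. w x * of_real (f (circle_point L x))) n + fcoeff L (\<lambda>x. w x * of_real (g (circle_point L x))) n" for n
    unfolding fcoeff_def
    by (subst Bochner_Integration.integral_add[symmetric])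
      (auto intro!: integrable_mult_fchar i simp: distrib_left distrib_right)
  moreover have "integrable (lebesgue_on {0..L}) (\<lambda>x. w x * of_real (f (circle_point L x) + g (circle_point L x)))"
    using i by (simp add: algebra_simps)
  ultimately show ?case using add by simp
next
  case (mult f g)
  have "integrable (lebesgue_on {0..L}) (\<lambda>x. w x * of_real (f (circle_point L x)))"
    "\<And>n. fcoeff L (\<lambda>x. w x * of_real (f (circle_point L x))) n = 0"
    using mult by auto
  from mult(4)[OF this] show ?case by (simp add: mult.assoc)
qed

lemma continuous_circle_orthogonal:
  fixes F :: "complex \<Rightarrow> real"
  assumes w: "integrable (lebesgue_on {0..L}) w" and w0: "\<And>n. fcoeff L w n = 0"
    and F: "continuous_on UNIV F"
  shows "integral\<^sup>L (lebesgue_on {0..L}) (\<lambda>x. w x * of_real (F (circle_point L x))) = 0" (is "?I = 0")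
proof -
  define W where "W = integral\<^sup>L (lebesgue_on {0..L}) (\<lambda>x. cmod (w x))"
  have circle_point: "circle_point L x \<in> sphere 0 1" for x by (simp add: circle_point_def)
  have mF: "(\<lambda>x. complex_of_real (F (circle_point L x))) \<in> borel_measurable (lebesgue_on {0..L})"
    unfolding circle_point_def
    by (intro continuous_on_imp_measurable_lebesgue_on continuous_intros
        continuous_on_compose2[OF F]) auto
  have bF: "compact (F ` sphere 0 1)"
    by (intro compact_continuous_image continuous_on_subset[OF F]) auto
  then obtain B where B: "\<And>z. z \<in> sphere 0 1 \<Longrightarrow> norm (F z) \<le> B"
    using compact_imp_bounded bounded_iff by (metis image_eqI)
  have iF: "integrable (lebesgue_on {0..L}) (\<lambda>x. w x * of_real (F (circle_point L x)))"
    by (rule integrable_mult_bounded_on_period[OF w mF, of B]) (use B circle_point in auto)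
  have le: "cmod ?I \<le> e * W" if e: "e > 0" for e
  proof -
    obtain q where q: "real_polynomial_function q" "\<And>z. z \<in> sphere 0 1 \<Longrightarrow> \<bar>F z - q z\<bar> < e"
      using Stone_Weierstrass_real_polynomial_function[of "sphere (0::complex) 1" F e,
        OF compact_sphere continuous_on_subset[OF F subset_UNIV] e] by metis
    note o = real_polynomial_orthogonal[OF q(1) w w0]
    have q0: "integral\<^sup>L (lebesgue_on {0..L}) (\<lambda>x. w x * of_real (q (circle_point L x))) = 0"
      using o[THEN conjunct2, rule_format, of 0] by (simp add: fcoeff_def)
    have "?I = ?I - integral\<^sup>L (lebesgue_on {0..L}) (\<lambda>x. w x * of_real (q (circle_point L x)))"
      using q0 by simp
    also have "\<dots> = integral\<^sup>L (lebesgue_on {0..L}) (\<lambda>x. w x * of_real (F (circle_point L x)) - w x * of_real (q (circle_point L x)))"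
      using o iF by simp
    also have "cmod \<dots> \<le> integral\<^sup>L (lebesgue_on {0..L}) (\<lambda>x. e * cmod (w x))"
    proof (rule Bochner_Integration.integral_norm_bound_integral)
      show "integrable (lebesgue_on {0..L}) (\<lambda>x. w x * of_real (F (circle_point L x)) - w x * of_real (q (circle_point L x)))"
        using o iF by simp
      show "integrable (lebesgue_on {0..L}) (\<lambda>x. e * cmod (w x))" using w by auto
      fix x
      have "cmod (w x * of_real (F (circle_point L x)) - w x * of_real (q (circle_point L x)))
        = cmod (w x) * \<bar>F (circle_point L x) - q (circle_point L x)\<bar>"
        by (simp add: norm_mult right_diff_distrib[symmetric] of_real_diff[symmetric] del: of_real_diff)
      also have "\<dots> \<le> e * cmod (w x)"
        using q(2)[OF circle_point, of x] by (subst mult.commute) (intro mult_right_mono, auto)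
      finally show "cmod (w x * of_real (F (circle_point L x)) - w x * of_real (q (circle_point L x))) \<le> e * cmod (w x)" .
    qed
    also have "\<dots> = e * W" by (simp add: W_def)
    finally show ?thesis .
  qed
  have W: "W \<ge> 0" by (simp add: W_def)
  have "cmod ?I \<le> 0"
  proof (rule field_le_epsilon)
    fix e :: real assume "e > 0"
    have "cmod ?I \<le> e / (W + 1) * W" using W \<open>e > 0\<close> by (intro le) auto
    also have "\<dots> \<le> e" using W \<open>e > 0\<close> by (simp add: field_simps)
    finally show "cmod ?I \<le> 0 + e" by simp
  qed
  then show ?thesis by simp
qed

lemma circle_point_eq_imp_eq: assumes "L > 0" "x \<in> {0..L}" "y \<in> {0<..<L}" "circle_point L x = circle_point L y" shows "x = y"
proof -
  have "sin (2 * pi * x / L) = sin (2 * pi * y / L)" "cos (2 * pi * x / L) = cos (2 * pi * y / L)"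
    using assms(4) by (auto simp: circle_point_def fchar_def complex_eq_iff)
  then obtain n :: int where n: "2 * pi * x / L = 2 * pi * y / L + 2 * n * pi"
    using sin_cos_eq_iff[of "2 * pi * x / L" "2 * pi * y / L"] by auto
  then have "2 * pi * x = 2 * pi * (y + n * L)"
    using assms(1) by (simp add: field_simps)
  then have xy: "x = y + n * L" by simp
  have "n < 1"
  proof (rule ccontr)
    assume "\<not> n < 1" then have "1 * L \<le> n * L" using assms(1) by (intro mult_right_mono) auto
    then show False using xy assms(2,3) unfolding atLeastAtMost_iff greaterThanLessThan_iff by linarith
  qed
  moreover have "n > -1"
  proof (rule ccontr)
    assume "\<not> n > -1" then have "n * L \<le> -1 * L" using assms(1) by (intro mult_right_mono) auto
    then show False using xy assms(2,3) unfolding atLeastAtMost_iff greaterThanLessThan_iff by linarith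
  qed
  ultimately show ?thesis using xy by simp
qed

text \<open>
  The indicator of a closed set is a bounded limit of continuous functions of the distance to
  that set. The distance is measured on the circle, and \<open>K\<close> avoids both ends of the period so
  that no other point of \<open>[0,L]\<close> is mapped into its image.
\<close>
lemma closed_orthogonal:
  assumes L: "L > 0" and w: "integrable (lebesgue_on {0..L}) w" and w0: "\<And>n. fcoeff L w n = 0"
    and K: "closed K" "K \<subseteq> {0<..<L}"
  shows "integral\<^sup>L (lebesgue_on {0..L}) (\<lambda>x. w x * of_real (indicator K x)) = 0"
proof (cases "K = {}")
  case False
  define C where "C = circle_point L ` K"
  define F where "F k z = max 0 (1 - real k * infdist z C)" for k z
  have "K \<subseteq> {0..L}" using K by auto
  then have "compact K" using K(1) bounded_subset[of "{0..L}" K] by (auto simp: compact_eq_bounded_closed)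
  then have C: "closed C" unfolding C_def circle_point_def
    by (intro compact_imp_closed compact_continuous_image continuous_intros)
  have C0: "C \<noteq> {}" using False by (simp add: C_def)
  have cF: "continuous_on UNIV (F k)" for k
    unfolding F_def by (intro continuous_intros)
  have F1: "0 \<le> F k z \<and> F k z \<le> 1" for k z
    by (simp add: F_def infdist_nonneg)
  have lim: "(\<lambda>k. F k (circle_point L x)) \<longlonglongrightarrow> indicator K x" if "x \<in> {0..L}" for x
  proof (cases "x \<in> K")
    case True
    then have "F k (circle_point L x) = 1" for k by (simp add: F_def C_def)
    then show ?thesis using True by simp
  next
    case False
    then have "circle_point L x \<notin> C"
      using circle_point_eq_imp_eq[OF L that] K by (force simp: C_def)
    then have pos: "infdist (circle_point L x) C > 0"
      using C C0 in_closed_iff_infdist_zero[OF C C0] infdist_nonneg[of "circle_point L x" C] by force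
    have "eventually (\<lambda>k. F k (circle_point L x) = 0) sequentially"
    proof -
      obtain k0 :: nat where k0: "1 / infdist (circle_point L x) C < k0" using reals_Archimedean2 by blast
      show ?thesis
      proof (rule eventually_sequentiallyI[of k0])
        fix k assume "k \<ge> k0"
        then have "1 / infdist (circle_point L x) C \<le> k" using k0 by linarith
        then show "F k (circle_point L x) = 0" using pos by (simp add: F_def field_simps)
      qed
    qed
    then show ?thesis using False by (simp add: tendsto_eventually)
  qed
  have mF: "(\<lambda>x. complex_of_real (F k (circle_point L x))) \<in> borel_measurable (lebesgue_on {0..L})" for k
    unfolding circle_point_def
    by (intro continuous_on_imp_measurable_lebesgue_on continuous_intros
        continuous_on_compose2[OF cF]) auto
  have Km: "K \<in> sets (lebesgue_on {0..L})"
    using K(1) \<open>K \<subseteq> {0..L}\<close> by (auto simp: sets_restrict_space image_iff intro!: bexI[of _ K])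
  have "(\<lambda>k. integral\<^sup>L (lebesgue_on {0..L}) (\<lambda>x. w x * of_real (F k (circle_point L x))))
     \<longlonglongrightarrow> integral\<^sup>L (lebesgue_on {0..L}) (\<lambda>x. w x * of_real (indicator K x))"
  proof (rule integral_dominated_convergence[where w = "\<lambda>x. cmod (w x)"])
    show "(\<lambda>x. w x * complex_of_real (indicat_real K x)) \<in> borel_measurable (lebesgue_on {0..L})"
      using w Km by measurable
    show "(\<lambda>x. w x * complex_of_real (F k (circle_point L x))) \<in> borel_measurable (lebesgue_on {0..L})" for k
      using w mF[of k] by measurable
    show "integrable (lebesgue_on {0..L}) (\<lambda>x. cmod (w x))" using w by auto
    show "AE x in lebesgue_on {0..L}. (\<lambda>k. w x * complex_of_real (F k (circle_point L x)))
        \<longlonglongrightarrow> w x * complex_of_real (indicat_real K x)"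
      by (rule AE_I2, intro tendsto_intros lim) auto
    show "AE x in lebesgue_on {0..L}. cmod (w x * complex_of_real (F k (circle_point L x))) \<le> cmod (w x)" for k
      using F1 by (intro AE_I2) (auto simp: norm_mult intro!: mult_left_le)
  qed
  moreover have "integral\<^sup>L (lebesgue_on {0..L}) (\<lambda>x. w x * of_real (F k (circle_point L x))) = 0" for k
    by (rule continuous_circle_orthogonal[OF w w0 cF])
  ultimately show ?thesis by (simp add: LIMSEQ_const_iff)
qed simp

text \<open>
  If the real part were positive on a set of positive measure, it would be so on a closed subset
  of positive measure by inner regularity. But the integral over every closed subset of the
  open interval vanishes.
\<close>
lemma orthogonal_imp_Re_nonpos:
  assumes L: "L > 0" and w: "integrable (lebesgue_on {0..L}) w" and w0: "\<And>n. fcoeff L w n = 0"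
  shows "AE x in lebesgue_on {0..L}. Re (w x) \<le> 0"
proof -
  define S where "S = {x \<in> {0<..<L}. Re (w x) > 0}"
  have mw: "(\<lambda>x. Re (w x)) \<in> borel_measurable (lebesgue_on {0..L})" using w by measurable
  have S: "S \<in> sets lebesgue"
  proof -
    have "S = {x \<in> space (lebesgue_on {0..L}). Re (w x) > 0} \<inter> {0<..<L}" by (auto simp: S_def)
    moreover have "{x \<in> space (lebesgue_on {0..L}). Re (w x) > 0} \<in> sets (lebesgue_on {0..L})"
      using mw by measurable
    ultimately show ?thesis
      by (auto simp: sets_restrict_space_iff intro: sets.Int)
  qed
  have null: "emeasure lebesgue K = 0" if K: "closed K" "K \<subseteq> S" for K
  proof -
    have KL: "K \<subseteq> {0<..<L}" using K by (auto simp: S_def)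
    then have KL': "K \<subseteq> {0..L}" by force
    have Km: "K \<in> sets (lebesgue_on {0..L})"
      using K(1) KL' by (auto simp: sets_restrict_space image_iff intro!: bexI[of _ K])
    have i: "integrable (lebesgue_on {0..L}) (\<lambda>x. w x * of_real (indicator K x))"
      by (rule integrable_mult_bounded_on_period[OF w, of _ 1]) (use Km in \<open>auto simp: indicator_def\<close>)
    have iR: "integrable (lebesgue_on {0..L}) (\<lambda>x. Re (w x) * indicator K x)"
      using integrable_Re[OF i] by simp
    have "integral\<^sup>L (lebesgue_on {0..L}) (\<lambda>x. Re (w x) * indicator K x) = 0"
      using integral_Re[OF i] closed_orthogonal[OF L w w0 K(1) KL] by simp
    then have "AE x in lebesgue_on {0..L}. Re (w x) * indicator K x = 0"
      using K by (subst integral_nonneg_eq_0_iff_AE[symmetric, OF iR])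
         (auto simp: indicator_def S_def intro!: AE_I2)
    then have "AE x in lebesgue_on {0..L}. x \<notin> K"
      by eventually_elim (use K in \<open>auto simp: S_def indicator_def\<close>)
    then have "K \<in> null_sets (lebesgue_on {0..L})"
      using AE_iff_null_sets[OF Km] by simp
    then show ?thesis
      using null_sets_restrict_space[of "{0..L}" lebesgue K] by auto
  qed
  have "emeasure lebesgue S \<le> 0"
  proof (rule ennreal_le_epsilon)
    fix e :: real assume "0 < e"
    obtain T where T: "closed T" "T \<subseteq> S" "S - T \<in> lmeasurable" "emeasure lebesgue (S - T) < ennreal e"
      using sets_lebesgue_inner_closed[OF S \<open>0 < e\<close>] .
    have "emeasure lebesgue S = emeasure lebesgue (T \<union> (S - T))"
      using T by (intro arg_cong[where f = "emeasure lebesgue"]) auto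
    also have "\<dots> \<le> emeasure lebesgue T + emeasure lebesgue (S - T)"
      using T S by (intro emeasure_subadditive) auto
    also have "\<dots> \<le> 0 + ennreal e"
      using T null[OF T(1,2)] by auto
    finally show "emeasure lebesgue S \<le> 0 + ennreal e" .
  qed
  then have "S \<in> null_sets lebesgue" using S by auto
  moreover have "{0, L} \<in> null_sets lebesgue" by (intro negligible_iff_null_sets[THEN iffD1] negligible_finite) auto
  ultimately have "S \<union> {0, L} \<in> null_sets lebesgue" by (rule null_sets.Un)
  then have "AE x in lebesgue. x \<notin> S \<union> {0, L}" by (rule AE_not_in)
  then have "AE x in lebesgue. x \<in> {0..L} \<longrightarrow> Re (w x) \<le> 0"
    by eventually_elim (auto simp: S_def not_less)
  then show ?thesis by (subst AE_restrict_space_iff) auto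
qed

text \<open>
  The one-sided estimate applies to \<open>w\<close> multiplied by the four fourth roots of unity.
\<close>
theorem fourier_complete:
  assumes L: "L > 0" and w: "integrable (lebesgue_on {0..L}) w" and w0: "\<And>n. fcoeff L w n = 0"
  shows "AE x in lebesgue_on {0..L}. w x = 0"
proof -
  have "AE x in lebesgue_on {0..L}. Re (c * w x) \<le> 0" for c
    by (rule orthogonal_imp_Re_nonpos[OF L]) (use w w0 in \<open>auto simp: fcoeff_cmult\<close>)
  from this[of 1] this[of "-1"] this[of \<i>] this[of "-\<i>"]
  show ?thesis by eventually_elim (auto simp: complex_eq_iff)
qed

section \<open>Decay from a convolution inequality\<close>

text \<open>
  Multiplying the recursive inequality by the weight \<open>v (|n|)\<close> and distributing that weight over
  the convolution by submultiplicativity bounds \<open>a v\<close> at \<open>n\<close> by its supremum times \<open>const / |n|\<close>,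
  hence by half of its supremum once \<open>|n|\<close> is large. The supremum is therefore controlled
  by the finitely many small indices. To know beforehand that it is finite, the weight is
  first truncated at a level \<open>M\<close>. The truncated weight obeys the same inequality with the same constants, so the
  resulting bound does not depend on \<open>M\<close>.
\<close>
theorem convolution_bootstrap:
  fixes a b :: "int \<Rightarrow> real" and v :: "nat \<Rightarrow> real"
  assumes a0: "\<And>n. 0 \<le> a n" and aA: "\<And>n. a n \<le> A" and b0: "\<And>n. 0 \<le> b n"
    and v1: "\<And>k. 1 \<le> v k" and v_mono: "\<And>i j. i \<le> j \<Longrightarrow> v i \<le> v j"
    and v_submult: "\<And>i j. v (i + j) \<le> v i * v j"
    and bv: "(\<lambda>k. b k * v (nat \<bar>k\<bar>)) summable_on UNIV"
    and \<alpha>: "\<alpha> > 0"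
    and rec: "\<And>n. \<alpha> * \<bar>real_of_int n\<bar> * a n \<le> \<beta> * a n + (\<Sum>\<^sub>\<infinity>m. b (n - m) * a m)"
  shows "\<exists>D. \<forall>n. a n * v (nat \<bar>n\<bar>) \<le> D"
proof -
  have vp: "v k > 0" for k using v1[of k] by linarith
  define B where "B = (\<Sum>\<^sub>\<infinity>k. b k * v (nat \<bar>k\<bar>))"
  have B: "B \<ge> 0" unfolding B_def using b0 vp by (intro infsum_nonneg) (simp add: less_imp_le)
  \<comment> \<open>Beyond \<open>K\<close> the factor \<open>\<alpha> |n| - \<beta>\<close> exceeds \<open>2 B\<close>, which yields the factor \<open>1/2\<close> below.\<close>
  obtain K :: nat where K: "(\<beta> + 2 * B) / \<alpha> < K" using reals_Archimedean2 by blast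
  have A: "A \<ge> 0" using a0 aA order_trans by blast
  have sumv: "((\<lambda>m. b (n - m) * v (nat \<bar>n - m\<bar>)) has_sum B) UNIV" for n
  proof -
    have "((\<lambda>k. b k * v (nat \<bar>k\<bar>)) has_sum B) UNIV" using bv by (simp add: B_def)
    then show ?thesis
      by (subst has_sum_reindex_bij_witness[where i = "\<lambda>m. n - m" and j = "\<lambda>m. n - m"
            and h = "\<lambda>k. b k * v (nat \<bar>k\<bar>)"]) auto
  qed
  have main: "a n * v (min (nat \<bar>n\<bar>) M) \<le> A * v K" for n M
  proof -
    define w where "w n = v (min (nat \<bar>n\<bar>) M)" for n :: int
    have w0: "w n > 0" for n by (simp add: w_def vp)
    define T where "T = (SUP n. a n * w n)"
    have "a n * w n \<le> A * v M" for n
      unfolding w_def by (intro mult_mono aA v_mono A less_imp_le[OF vp]) auto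
    then have bdd: "bdd_above (range (\<lambda>n. a n * w n))" by (intro bdd_aboveI2)
    have T: "a n * w n \<le> T" for n unfolding T_def by (rule cSUP_upper[OF _ bdd]) simp
    have T0: "T \<ge> 0" using order_trans[OF mult_nonneg_nonneg[OF a0 less_imp_le[OF w0]] T] .
    have wle: "w n \<le> v (nat \<bar>n - m\<bar>) * w m" for n m
    proof -
      have "w n \<le> v (nat \<bar>n - m\<bar> + min (nat \<bar>m\<bar>) M)" unfolding w_def by (rule v_mono) linarith
      also have "\<dots> \<le> v (nat \<bar>n - m\<bar>) * w m" unfolding w_def by (rule v_submult)
      finally show ?thesis .
    qed
    have step: "a n * w n \<le> max (A * v K) (T / 2)" for n
    proof (cases "nat \<bar>n\<bar> \<le> K")
      case True
      have "a n * w n \<le> A * v K"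
        unfolding w_def using True by (intro mult_mono aA v_mono A less_imp_le[OF vp]) auto
      then show ?thesis by simp
    next
      case False
      have sumT: "((\<lambda>m. b (n - m) * v (nat \<bar>n - m\<bar>) * T) has_sum (B * T)) UNIV"
        by (rule has_sum_cmult_left[OF sumv])
      have le: "b (n - m) * a m * w n \<le> b (n - m) * v (nat \<bar>n - m\<bar>) * T" for m
      proof -
        have "b (n - m) * a m * w n \<le> b (n - m) * a m * (v (nat \<bar>n - m\<bar>) * w m)"
          using a0 b0 by (intro mult_left_mono wle) simp
        also have "\<dots> = b (n - m) * v (nat \<bar>n - m\<bar>) * (a m * w m)" by (simp add: mult_ac)
        also have "\<dots> \<le> b (n - m) * v (nat \<bar>n - m\<bar>) * T"
          using b0 vp by (intro mult_left_mono T) (simp add: less_imp_le)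
        finally show ?thesis .
      qed
      have summ: "(\<lambda>m. b (n - m) * a m * w n) summable_on UNIV"
        by (rule summable_on_comparison_test[OF has_sum_imp_summable[OF sumT]])
          (use le a0 b0 w0 in \<open>auto simp: less_imp_le\<close>)
      have "(\<alpha> * \<bar>real_of_int n\<bar> - \<beta>) * a n * w n \<le> (\<Sum>\<^sub>\<infinity>m. b (n - m) * a m) * w n"
        using rec[of n] w0[of n] by (intro mult_right_mono) (auto simp: algebra_simps less_imp_le)
      also have "\<dots> = (\<Sum>\<^sub>\<infinity>m. b (n - m) * a m * w n)"
        by (simp add: infsum_cmult_left')
      also have "\<dots> \<le> B * T"
        using infsum_mono[OF summ has_sum_imp_summable[OF sumT]] le infsumI[OF sumT] by simp
      finally have 1: "(\<alpha> * \<bar>real_of_int n\<bar> - \<beta>) * (a n * w n) \<le> B * T" by (simp add: mult.assoc)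
      have "real K < \<bar>real_of_int n\<bar>" using False by linarith
      then have "(\<beta> + 2 * B) / \<alpha> < \<bar>real_of_int n\<bar>" using K by linarith
      then have gt: "2 * B < \<alpha> * \<bar>real_of_int n\<bar> - \<beta>" using \<alpha> by (simp add: field_simps)
      have aw: "a n * w n \<ge> 0" using a0 w0 by (simp add: less_imp_le)
      have "a n * w n \<le> T / 2"
      proof (rule ccontr)
        assume *: "\<not> a n * w n \<le> T / 2"
        then have "a n * w n > 0" using T0 by linarith
        have "B * T \<le> (2 * B) * (a n * w n)" 
          using mult_left_mono[of "T / 2" "a n * w n" "2 * B"] * B by simp
        also have "\<dots> < (\<alpha> * \<bar>real_of_int n\<bar> - \<beta>) * (a n * w n)"
          using gt \<open>a n * w n > 0\<close> by (rule mult_strict_right_mono)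
        finally show False using 1 by simp
      qed
      then show ?thesis by simp
    qed
    have "T \<le> max (A * v K) (T / 2)"
      unfolding T_def by (rule cSUP_least) (use step in \<open>auto simp: T_def\<close>)
    then have "T \<le> A * v K" using T0 A vp[of K] by (auto simp: max_def split: if_splits)
    then show ?thesis using T[of n] unfolding w_def by linarith
  qed
  show ?thesis by (intro exI[of _ "A * v K"] allI) (metis main min.idem)
qed

section \<open>An eigenvalue of a Hermitian matrix near a given number\<close>

lemma linear_term_zero:
  fixes \<alpha> \<beta> :: real
  assumes "\<And>t. 0 \<le> 2 * t * \<alpha> + t\<^sup>2 * \<beta>"
  shows "\<alpha> = 0"
proof (rule ccontr)
  assume "\<alpha> \<noteq> 0"
  define s where "s = \<bar>\<beta>\<bar> + 1"
  have s: "s > 0" "\<beta> \<le> s" by (auto simp: s_def)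
  have "0 \<le> 2 * (- \<alpha> / s) * \<alpha> + (- \<alpha> / s)\<^sup>2 * \<beta>" by (rule assms)
  also have "\<dots> \<le> 2 * (- \<alpha> / s) * \<alpha> + (- \<alpha> / s)\<^sup>2 * s"
    using s by (intro add_left_mono mult_left_mono) auto
  also have "\<dots> = - (\<alpha>\<^sup>2 / s)"
    using s(1) by (simp add: power2_eq_square)
  also have "\<dots> < 0" using \<open>\<alpha> \<noteq> 0\<close> s by simp
  finally show False by simp
qed

text \<open>
  The number \<open>\<nu>\<close> is, up to sign, the minimum of \<open>|H x|\<close> over the unit sphere. At a minimiser \<open>c0\<close> the
  first variation of \<open>|H x|\<^sup>2 - \<nu>\<^sup>2 |x|\<^sup>2\<close> vanishes, which says \<open>H\<^sup>2 c0 = \<nu>\<^sup>2 c0\<close> as \<open>H\<close> is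
  Hermitian. Then \<open>(H - \<nu>) (H + \<nu>) c0 = 0\<close>. So either \<open>(H + \<nu>) c0\<close> is an eigenvector for
  \<open>\<nu>\<close>, or it is zero and \<open>c0\<close> is an eigenvector for \<open>-\<nu>\<close>.
\<close>
theorem hermitian_eigenvalue_bound:
  fixes H :: "'i \<Rightarrow> 'i \<Rightarrow> complex"
  assumes S: "finite S" "S \<noteq> {}"
    and herm: "\<And>i j. i \<in> S \<Longrightarrow> j \<in> S \<Longrightarrow> H i j = cnj (H j i)"
  obtains c \<nu> where "\<exists>i\<in>S. c i \<noteq> 0" "\<And>i. i \<in> S \<Longrightarrow> (\<Sum>j\<in>S. H i j * c j) = of_real \<nu> * c i"
    "\<And>x. \<nu>\<^sup>2 * (\<Sum>i\<in>S. (cmod (x i))\<^sup>2) \<le> (\<Sum>i\<in>S. (cmod (\<Sum>j\<in>S. H i j * x j))\<^sup>2)"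
proof -
  define app where "app c i = (\<Sum>j\<in>S. H i j * c j)" for c i
  define \<Phi> where "\<Phi> c = (\<Sum>i\<in>S. (cmod (app c i))\<^sup>2)" for c
  define nrm where "nrm c = (\<Sum>i\<in>S. (cmod (c i))\<^sup>2)" for c :: "'i \<Rightarrow> complex"
  \<comment> \<open>The unit sphere, with entries outside \<open>S\<close> set to \<open>0\<close> so that it is compact in the product topology.\<close>
  define Sp where "Sp = PiE UNIV (\<lambda>i. if i \<in> S then cball (0::complex) 1 else {0}) \<inter> {c. nrm c = 1}"
  have coord: "continuous_on X (\<lambda>c :: 'i \<Rightarrow> complex. c i)" for X i
    by (rule continuous_on_subset[OF continuous_on_product_coordinates subset_UNIV])
  have "compact (PiE UNIV (\<lambda>i. if i \<in> S then cball (0::complex) 1 else {0}))"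
    using compactin_PiE[of "\<lambda>_. euclidean :: complex topology" UNIV "\<lambda>i. if i \<in> S then cball (0::complex) 1 else {0}"]
    by (simp add: euclidean_product_topology compactin_euclidean_iff)
  moreover have "closed {c. nrm c = 1}"
    unfolding nrm_def by (intro closed_Collect_eq continuous_intros coord)
  ultimately have cSp: "compact Sp" unfolding Sp_def by (rule compact_Int_closed)
  obtain i0 where i0: "i0 \<in> S" using S by auto
  have "nrm (\<lambda>i. if i = i0 then 1 else 0) = (\<Sum>i\<in>S. if i = i0 then 1 else 0)"
    unfolding nrm_def by (rule sum.cong) auto
  then have "(\<lambda>i. if i = i0 then 1 else 0) \<in> Sp"
    using i0 S by (simp add: Sp_def PiE_UNIV_domain)
  then have Sp0: "Sp \<noteq> {}" by auto
  have "continuous_on Sp \<Phi>"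
    unfolding \<Phi>_def app_def by (intro continuous_intros coord)
  then obtain c0 where c0: "c0 \<in> Sp" "\<And>c. c \<in> Sp \<Longrightarrow> \<Phi> c0 \<le> \<Phi> c"
    using continuous_attains_inf[OF cSp Sp0] by blast
  have nrm0: "nrm c0 = 1" using c0(1) by (simp add: Sp_def)
  define m2 where "m2 = \<Phi> c0"
  have m2: "m2 \<ge> 0" by (simp add: m2_def \<Phi>_def sum_nonneg)
  have min: "m2 * nrm y \<le> \<Phi> y" for y
  proof (cases "nrm y = 0")
    case True
    moreover have "0 \<le> \<Phi> y" unfolding \<Phi>_def by (intro sum_nonneg) simp
    ultimately show ?thesis by simp
  next
    case False
    moreover have "0 \<le> nrm y" unfolding nrm_def by (intro sum_nonneg) simp
    ultimately have pos: "nrm y > 0" by simp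
    define s where "s = sqrt (nrm y)"
    have s: "s > 0" "s\<^sup>2 = nrm y" using pos by (auto simp: s_def)
    define z where "z i = (if i \<in> S then y i / of_real s else 0)" for i
    have "nrm z = (\<Sum>i\<in>S. (cmod (y i))\<^sup>2 / s\<^sup>2)"
      unfolding nrm_def by (rule sum.cong) (use s(1) in \<open>auto simp: z_def norm_divide power_divide\<close>)
    also have "\<dots> = nrm y / s\<^sup>2" by (simp only: nrm_def sum_divide_distrib)
    finally have nz: "nrm z = 1" using s(2) pos by simp
    have "z \<in> Sp"
    proof -
      have "cmod (z i) \<le> 1" if "i \<in> S" for i
      proof -
        have "(cmod (z i))\<^sup>2 \<le> nrm z" unfolding nrm_def by (rule member_le_sum) (use that S in auto)
        then have "(cmod (z i))\<^sup>2 \<le> 1\<^sup>2" using nz by simp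
        then show ?thesis by (rule power2_le_imp_le) simp
      qed
      then have "\<forall>i. z i \<in> (if i \<in> S then cball 0 1 else {0})" by (simp add: z_def)
      then show ?thesis using nz by (simp add: Sp_def PiE_UNIV_domain)
    qed
    then have "m2 \<le> \<Phi> z" unfolding m2_def by (rule c0(2))
    also have "\<Phi> z = \<Phi> y / nrm y"
    proof -
      have "app z i = app y i / of_real s" for i
        unfolding app_def sum_divide_distrib by (rule sum.cong) (auto simp: z_def)
      then have "\<Phi> z = (\<Sum>i\<in>S. (cmod (app y i))\<^sup>2 / s\<^sup>2)"
        unfolding \<Phi>_def using s(1) by (simp only: norm_divide power_divide norm_of_real abs_of_pos)
      also have "\<dots> = \<Phi> y / nrm y" by (simp only: \<Phi>_def sum_divide_distrib s(2))
      finally show ?thesis .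
    qed
    finally show ?thesis using pos by (simp add: field_simps)
  qed
  \<comment> \<open>Varying \<open>c0\<close> in the direction of the residual of \<open>H\<^sup>2 c0 = m2 c0\<close> shows that this residual vanishes.\<close>
  define R where "R i = app (app c0) i - of_real m2 * c0 i" for i
  have nexp: "(cmod (x + of_real t * y))\<^sup>2 = (cmod x)\<^sup>2 + 2 * t * Re (x * cnj y) + t\<^sup>2 * (cmod y)\<^sup>2" for x y t
    unfolding cmod_power2 by (simp add: power2_eq_square algebra_simps)
  have "(\<Sum>i\<in>S. Re (app c0 i * cnj (app R i))) - m2 * (\<Sum>i\<in>S. Re (c0 i * cnj (R i))) = 0"
  proof (rule linear_term_zero)
    fix t
    define y where "y i = c0 i + of_real t * R i" for i
    have appy: "app y i = app c0 i + of_real t * app R i" for i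
      by (simp add: app_def y_def sum.distrib sum_distrib_left algebra_simps)
    have "0 \<le> \<Phi> y - m2 * nrm y" using min[of y] by simp
    also have "\<Phi> y = m2 + 2 * t * (\<Sum>i\<in>S. Re (app c0 i * cnj (app R i))) + t\<^sup>2 * \<Phi> R"
      unfolding m2_def \<Phi>_def appy nexp by (simp only: sum.distrib sum_distrib_left)
    also have "nrm y = 1 + 2 * t * (\<Sum>i\<in>S. Re (c0 i * cnj (R i))) + t\<^sup>2 * nrm R"
      unfolding nrm0[symmetric] unfolding nrm_def y_def nexp by (simp only: sum.distrib sum_distrib_left)
    finally show "0 \<le> 2 * t * ((\<Sum>i\<in>S. Re (app c0 i * cnj (app R i))) - m2 * (\<Sum>i\<in>S. Re (c0 i * cnj (R i))))
        + t\<^sup>2 * (\<Phi> R - m2 * nrm R)"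
      by (simp add: algebra_simps)
  qed
  moreover have "(\<Sum>i\<in>S. app c0 i * cnj (app R i)) = (\<Sum>i\<in>S. app (app c0) i * cnj (R i))"
  proof -
    have "(\<Sum>i\<in>S. app c0 i * cnj (app R i)) = (\<Sum>i\<in>S. \<Sum>j\<in>S. H j i * app c0 i * cnj (R j))"
      unfolding app_def[of R] cnj_sum sum_distrib_left
    proof (intro sum.cong refl)
      fix i j assume "i \<in> S" "j \<in> S"
      then have "cnj (H i j) = H j i" using herm[of j i] by simp
      then show "app c0 i * cnj (H i j * R j) = H j i * app c0 i * cnj (R j)" by simp
    qed
    also have "\<dots> = (\<Sum>j\<in>S. app (app c0) j * cnj (R j))"
      by (subst sum.swap) (simp add: app_def[of "app c0"] sum_distrib_right)
    finally show ?thesis .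
  qed
  ultimately have "(\<Sum>i\<in>S. Re (app (app c0) i * cnj (R i))) - m2 * (\<Sum>i\<in>S. Re (c0 i * cnj (R i))) = 0"
    by (simp only: Re_sum[symmetric])
  moreover have "Re (app (app c0) i * cnj (R i)) - m2 * Re (c0 i * cnj (R i)) = (cmod (R i))\<^sup>2" for i
  proof -
    have "Re (app (app c0) i * cnj (R i)) - m2 * Re (c0 i * cnj (R i)) = Re (R i * cnj (R i))"
      by (simp add: R_def algebra_simps)
    also have "\<dots> = (cmod (R i))\<^sup>2" by (simp only: complex_norm_square[symmetric] Re_complex_of_real)
    finally show ?thesis .
  qed
  ultimately have "(\<Sum>i\<in>S. (cmod (R i))\<^sup>2) = 0"
    by (simp only: sum_distrib_left sum_subtractf[symmetric])
  then have R0: "R i = 0" if "i \<in> S" for i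
    using S that by (simp add: sum_nonneg_eq_0_iff)
  define \<mu> where "\<mu> = sqrt m2"
  have \<mu>: "\<mu>\<^sup>2 = m2" using m2 by (simp add: \<mu>_def)
  have sq: "app (app c0) i = of_real \<mu> * of_real \<mu> * c0 i" if "i \<in> S" for i
    using R0[OF that] \<mu> by (simp add: R_def power2_eq_square flip: of_real_mult)
  have bnd: "\<mu>\<^sup>2 * (\<Sum>i\<in>S. (cmod (x i))\<^sup>2) \<le> (\<Sum>i\<in>S. (cmod (\<Sum>j\<in>S. H i j * x j))\<^sup>2)" for x
    using min[of x] by (simp add: \<mu> \<Phi>_def nrm_def app_def)
  define d where "d i = app c0 i + of_real \<mu> * c0 i" for i
  show ?thesis
  proof (cases "\<exists>i\<in>S. d i \<noteq> 0")
    case True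
    show ?thesis
    proof (rule that[of d \<mu>])
      fix i assume i: "i \<in> S"
      have "(\<Sum>j\<in>S. H i j * d j) = app (app c0) i + of_real \<mu> * app c0 i"
        by (simp add: d_def app_def[of "app c0"] app_def[of c0 i] sum.distrib sum_distrib_left algebra_simps)
      also have "\<dots> = of_real \<mu> * d i" using sq[OF i] by (simp add: d_def algebra_simps)
      finally show "(\<Sum>j\<in>S. H i j * d j) = of_real \<mu> * d i" .
    qed (use True bnd in auto)
  next
    case False
    show ?thesis
    proof (rule that[of c0 "- \<mu>"])
      show "\<exists>i\<in>S. c0 i \<noteq> 0"
      proof (rule ccontr)
        assume "\<not> ?thesis" then have "nrm c0 = 0" by (simp add: nrm_def)
        then show False using nrm0 by simp
      qed
      show "(\<Sum>j\<in>S. H i j * c0 j) = of_real (- \<mu>) * c0 i" if "i \<in> S" for i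
        using False that by (simp add: d_def app_def add_eq_0_iff2)
    qed (use bnd in auto)
  qed
qed

section \<open>Fourier coefficients and differentiation\<close>

text \<open>
  The factor by which differentiation multiplies \<open>fchar L n\<close>.
\<close>
definition freq :: "real \<Rightarrow> int \<Rightarrow> complex" where
  "freq L n = - (\<i> * of_real (2 * pi * of_int n / L))"

lemma freq_minus: "freq L (- n) = - freq L n"
  by (simp add: freq_def)

lemma norm_freq: "L > 0 \<Longrightarrow> cmod (freq L n) = 2 * pi / L * \<bar>real_of_int n\<bar>"
  by (simp add: freq_def norm_mult norm_divide)

lemma fchar_exp: "fchar L n x = exp (freq L n * of_real x)"
  by (simp add: fchar_def freq_def cis_conv_exp algebra_simps)

lemma fourier_basis_eq: "fourier_basis L n x = of_real (1 / sqrt L) * fchar L n x"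
  by (simp add: fourier_basis_def fchar_exp freq_def algebra_simps)

lemma inner_fourier_basis: "inner_L2 L u (fourier_basis L n) = of_real (1 / sqrt L) * fcoeff L u n"
  unfolding inner_L2_def fcoeff_def fourier_basis_eq
  by (simp add: cnj_fchar mult.left_commute)

lemma fourier_trunc_eq:
  assumes "L > 0"
  shows "fourier_trunc L N u x = (\<Sum>n = - int N..int N. fcoeff L u n / of_real L * fchar L n x)"
proof -
  have "complex_of_real (sqrt L) * complex_of_real (sqrt L) = of_real L"
    using assms by (simp flip: of_real_mult)
  then show ?thesis
    unfolding fourier_trunc_def inner_fourier_basis fourier_basis_eq
    by (intro sum.cong refl) (simp add: field_simps)
qed

lemma has_vector_derivative_fchar:
  "(fchar L n has_vector_derivative freq L n * fchar L n x) (at x)"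
  unfolding fchar_exp
  by (rule has_vector_derivative_real_field[THEN has_vector_derivative_eq_rhs]) 
     (auto intro!: derivative_eq_intros)

lemma periodic_fchar: "L > 0 \<Longrightarrow> periodic L (fchar L n)"
proof -
  assume "L > 0"
  then have "- (2 * pi * n * (x + L) / L) = - (2 * pi * n * x / L) + - (2 * pi * n)" for x
    by (simp add: field_simps)
  then have "fchar L n (x + L) = fchar L n x * cis (- (2 * pi * n))" for x
    by (simp only: fchar_def cis_mult)
  moreover have "cis (- (2 * pi * n)) = 1"
    by (metis cis_multiple_2pi Ints_of_int Ints_minus mult_minus_right)
  ultimately show ?thesis by (simp add: periodic_def)
qed

lemma nth_deriv_0 [simp]: "nth_deriv 0 u = u"
  by (simp add: nth_deriv_def)

lemma nth_deriv_Suc: "nth_deriv (Suc j) u = (\<lambda>x. vector_derivative (nth_deriv j u) (at x))"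
  by (simp add: nth_deriv_def)

lemma nth_deriv_fchar: "nth_deriv j (fchar L n) = (\<lambda>x. freq L n ^ j * fchar L n x)"
proof (induction j)
  case (Suc j)
  show ?case unfolding nth_deriv_Suc Suc
    by (intro ext vector_derivative_at)
      (auto intro!: derivative_eq_intros has_vector_derivative_mult_right[THEN has_vector_derivative_eq_rhs] has_vector_derivative_fchar)
qed simp

lemma smooth_fchar: "smooth (fchar L n)"
  unfolding smooth_def nth_deriv_fchar
  by (auto intro!: differentiable_mult differentiableI_vector has_vector_derivative_fchar)

lemma smooth_deriv:
  assumes "smooth u"
  shows "(nth_deriv j u has_vector_derivative nth_deriv (Suc j) u x) (at x)"
  using assms by (simp add: smooth_def nth_deriv_Suc vector_derivative_works)

lemma smooth_continuous: "smooth u \<Longrightarrow> continuous_on S (nth_deriv j u)"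
  by (meson smooth_deriv continuous_at_imp_continuous_on has_vector_derivative_continuous)

lemma periodic_nth_deriv:
  assumes "smooth u" "periodic L u"
  shows "periodic L (nth_deriv j u)"
proof (induction j)
  case (Suc j)
  show ?case unfolding periodic_def
  proof
    fix x
    have "((nth_deriv j u \<circ> (\<lambda>y. y + L)) has_vector_derivative (1 *\<^sub>R nth_deriv (Suc j) u (x + L))) (at x)"
      by (rule vector_diff_chain_at) (auto intro!: derivative_eq_intros smooth_deriv assms)
    moreover have "nth_deriv j u \<circ> (\<lambda>y. y + L) = nth_deriv j u"
      using Suc by (auto simp: periodic_def)
    ultimately show "nth_deriv (Suc j) u (x + L) = nth_deriv (Suc j) u x"
      using smooth_deriv[OF assms(1), of j x] vector_derivative_unique_at by (metis scaleR_one)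
  qed
qed (use assms in simp)

lemma continuous_integrable_period:
  fixes h :: "real \<Rightarrow> complex"
  assumes "continuous_on UNIV h" shows "integrable (lebesgue_on {a..b}) h"
  using continuous_imp_integrable[of a b h] continuous_on_subset[OF assms] by simp

lemma integral_derivative_periodic:
  fixes h :: "real \<Rightarrow> complex"
  assumes "L > 0" and d: "\<And>x. (h has_vector_derivative h' x) (at x)" and c: "continuous_on UNIV h'" and "h L = h 0"
  shows "integral\<^sup>L (lebesgue_on {0..L}) h' = 0"
proof -
  have "(h' has_integral h L - h 0) {0..L}"
    using assms by (intro fundamental_theorem_of_calculus)
      (auto intro: has_vector_derivative_at_within)
  then show ?thesis
    using lebesgue_integral_eq_integral[OF continuous_integrable_period[OF c, of 0 L]] assms
    by (simp add: integral_unique)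
qed

text \<open>
  Integration by parts: the derivative of a periodic product integrates to \<open>0\<close> over a period.
\<close>
lemma fcoeff_nth_deriv:
  assumes L: "L > 0" and u: "smooth u" "periodic L u"
  shows "fcoeff L (nth_deriv j u) n = freq L n ^ j * fcoeff L u n"
proof (induction j)
  case (Suc j)
  let ?d = "\<lambda>x. nth_deriv (Suc j) u x * fchar L (- n) x - freq L n * (nth_deriv j u x * fchar L (- n) x)"
  have i: "integrable (lebesgue_on {0..L}) (\<lambda>x. nth_deriv i u x * fchar L (- n) x)" for i
    by (intro continuous_integrable_period continuous_intros smooth_continuous u)
  have "integral\<^sup>L (lebesgue_on {0..L}) ?d = 0"
  proof (rule integral_derivative_periodic[OF L])
    show "((\<lambda>x. nth_deriv j u x * fchar L (- n) x) has_vector_derivative ?d x) (at x)" for x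
      by (rule has_vector_derivative_eq_rhs[OF has_vector_derivative_mult[OF smooth_deriv[OF u(1)] has_vector_derivative_fchar]])
        (simp add: freq_minus)
    show "continuous_on UNIV ?d"
      by (intro continuous_intros smooth_continuous u)
    show "nth_deriv j u L * fchar L (- n) L = nth_deriv j u 0 * fchar L (- n) 0"
      using periodic_nth_deriv[OF u, of j] periodic_fchar[OF L, of "- n"]
      by (metis periodic_def add_0)
  qed
  moreover have "integral\<^sup>L (lebesgue_on {0..L}) ?d = fcoeff L (nth_deriv (Suc j) u) n - freq L n * fcoeff L (nth_deriv j u) n"
    unfolding fcoeff_def by (subst Bochner_Integration.integral_diff) (use i in auto)
  ultimately show ?case using Suc by simp
qed simp

lemma fcoeff_one: assumes L: "L > 0" shows "fcoeff L (\<lambda>x. 1) n = (if n = 0 then of_real L else 0)"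
proof (cases "n = 0")
  case True
  then show ?thesis using L by (simp add: fcoeff_def measure_restrict_space scaleR_conv_of_real)
next
  case False
  have 1: "(\<lambda>x. 1) = fchar L 0" by auto
  have "nth_deriv 1 (\<lambda>x. 1) = (\<lambda>x. 0)"
    unfolding 1 nth_deriv_fchar by (simp add: freq_def)
  then have "freq L n * fcoeff L (\<lambda>x. 1) n = 0"
    using fcoeff_nth_deriv[OF L smooth_fchar periodic_fchar[OF L], of 1 0 n] unfolding 1
    by (simp add: fcoeff_def)
  moreover have "freq L n \<noteq> 0" using False L by (simp add: freq_def)
  ultimately show ?thesis using False by simp
qed

lemma fcoeff_mult_fchar: "fcoeff L (\<lambda>x. g x * fchar L k x) n = fcoeff L g (n - k)"
  unfolding fcoeff_def mult.assoc fchar_add by simp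

lemma fcoeff_fchar: assumes L: "L > 0" shows "fcoeff L (fchar L k) n = (if n = k then of_real L else 0)"
  using fcoeff_mult_fchar[of L "\<lambda>x. 1" k n] fcoeff_one[OF L, of "n - k"] by auto

section \<open>Fourier series of a product\<close>

text \<open>
  An absolutely convergent Fourier series converges uniformly, so it may be integrated term by
  term against any integrable function.
\<close>
lemma integral_fourier_series:
  assumes c: "(\<lambda>k. cmod (c k)) summable_on UNIV" and g: "integrable (lebesgue_on {0..L}) g"
  defines "G \<equiv> \<lambda>x. \<Sum>\<^sub>\<infinity>k. c k * fchar L k x"
  shows "continuous_on UNIV G"
    and "((\<lambda>k. c k * fcoeff L g (n - k)) has_sum fcoeff L (\<lambda>x. G x * g x) n) UNIV"
proof -
  define C where "C = (\<Sum>\<^sub>\<infinity>k. cmod (c k))"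
  have sm: "(\<lambda>k. cmod (c k * fchar L k x)) summable_on UNIV" for x
    using c by (simp add: norm_mult)
  have hs: "((\<lambda>k. c k * fchar L k x) has_sum G x) UNIV" for x
    unfolding G_def using abs_summable_summable[OF sm] by simp
  have C: "((\<lambda>k. cmod (c k)) has_sum C) UNIV" using c by (simp add: C_def)
  have diff: "cmod (G x - (\<Sum>k\<in>F. c k * fchar L k x)) \<le> C - (\<Sum>k\<in>F. cmod (c k))" if F: "finite F" for F x
  proof -
    have "((\<lambda>k. c k * fchar L k x) has_sum (G x - (\<Sum>k\<in>F. c k * fchar L k x))) (UNIV - F)"
      using F by (intro has_sum_Diff[OF hs has_sum_finite]) auto
    moreover have "((\<lambda>k. cmod (c k)) has_sum (C - (\<Sum>k\<in>F. cmod (c k)))) (UNIV - F)"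
      using F by (intro has_sum_Diff[OF C has_sum_finite]) auto
    ultimately show ?thesis
      by (rule norm_infsum_le) (auto simp: norm_mult)
  qed
  have tail: "((\<lambda>F. C - (\<Sum>k\<in>F. cmod (c k))) \<longlongrightarrow> 0) (finite_subsets_at_top UNIV)"
    using tendsto_diff[OF tendsto_const C[unfolded has_sum_def], of C] by simp
  have ul: "uniform_limit UNIV (\<lambda>F x. \<Sum>k\<in>F. c k * fchar L k x) G (finite_subsets_at_top UNIV)"
    unfolding uniform_limit_iff
  proof (intro allI impI)
    fix e :: real assume "e > 0"
    then have "\<forall>\<^sub>F F in finite_subsets_at_top UNIV. C - (\<Sum>k\<in>F. cmod (c k)) < e"
      using tail by (metis order_tendstoD(2))
    moreover have "\<forall>\<^sub>F F in finite_subsets_at_top (UNIV :: int set). finite F"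
      by (rule eventually_finite_subsets_at_top_weakI)
    ultimately show "\<forall>\<^sub>F F in finite_subsets_at_top UNIV. \<forall>x\<in>UNIV. dist (\<Sum>k\<in>F. c k * fchar L k x) (G x) < e"
    proof eventually_elim
      case (elim F)
      then show ?case using diff[of F] by (auto simp: dist_norm norm_minus_commute intro: le_less_trans)
    qed
  qed
  show cG: "continuous_on UNIV G"
    by (rule uniform_limit_theorem[OF _ ul]) (auto intro!: always_eventually continuous_intros)
  define I where "I = integral\<^sup>L (lebesgue_on {0..L}) (\<lambda>x. cmod (g x))"
  have Gb: "cmod (G x) \<le> C" for x using diff[of "{}" x] by simp
  have iG: "integrable (lebesgue_on {0..L}) (\<lambda>x. g x * (G x * fchar L (- n) x))"
    by (rule integrable_mult_bounded_on_period[OF g, where B = C])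
      (use Gb in \<open>auto simp: norm_mult intro!: continuous_on_imp_measurable_lebesgue_on continuous_intros cG\<close>)
  show "((\<lambda>k. c k * fcoeff L g (n - k)) has_sum fcoeff L (\<lambda>x. G x * g x) n) UNIV"
    unfolding has_sum_def
  proof (rule LIM_zero_cancel, rule Lim_null_comparison)
    show "((\<lambda>F. (C - (\<Sum>k\<in>F. cmod (c k))) * I) \<longlongrightarrow> 0) (finite_subsets_at_top UNIV)"
      using tendsto_mult_left_zero[OF tail] .
    show "\<forall>\<^sub>F F in finite_subsets_at_top UNIV.
       norm ((\<Sum>k\<in>F. c k * fcoeff L g (n - k)) - fcoeff L (\<lambda>x. G x * g x) n) \<le> (C - (\<Sum>k\<in>F. cmod (c k))) * I"
    proof (rule eventually_finite_subsets_at_top_weakI)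
      fix F :: "int set" assume F: "finite F"
      have ik: "integrable (lebesgue_on {0..L}) (\<lambda>x. c k * (g x * fchar L (k - n) x))" for k
        by (intro integrable_mult_right integrable_mult_fchar g)
      have "(\<Sum>k\<in>F. c k * fcoeff L g (n - k)) = integral\<^sup>L (lebesgue_on {0..L}) (\<lambda>x. \<Sum>k\<in>F. c k * (g x * fchar L (k - n) x))"
        by (subst Bochner_Integration.integral_sum) (use ik in \<open>auto simp: fcoeff_def\<close>)
      also have "\<dots> - fcoeff L (\<lambda>x. G x * g x) n =
        integral\<^sup>L (lebesgue_on {0..L}) (\<lambda>x. (\<Sum>k\<in>F. c k * (g x * fchar L (k - n) x)) - g x * (G x * fchar L (- n) x))"
        unfolding fcoeff_def
        by (subst Bochner_Integration.integral_diff[OF _ iG]) (auto intro!: Bochner_Integration.integrable_sum ik simp: mult_ac)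
      also have "norm \<dots> \<le> integral\<^sup>L (lebesgue_on {0..L}) (\<lambda>x. (C - (\<Sum>k\<in>F. cmod (c k))) * cmod (g x))"
      proof (rule Bochner_Integration.integral_norm_bound_integral)
        fix x
        have "(\<Sum>k\<in>F. c k * (g x * fchar L (k - n) x)) = g x * fchar L (- n) x * (\<Sum>k\<in>F. c k * fchar L k x)"
          unfolding sum_distrib_left
        proof (intro sum.cong refl)
          fix k
          show "c k * (g x * fchar L (k - n) x) = g x * fchar L (- n) x * (c k * fchar L k x)"
            using fchar_add[of L k x "- n"] by (simp add: mult_ac)
        qed
        then have "norm ((\<Sum>k\<in>F. c k * (g x * fchar L (k - n) x)) - g x * (G x * fchar L (- n) x))
          = norm (g x * fchar L (- n) x * ((\<Sum>k\<in>F. c k * fchar L k x) - G x))"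
          by (simp add: algebra_simps)
        also have "\<dots> = cmod (g x) * cmod (G x - (\<Sum>k\<in>F. c k * fchar L k x))"
          by (simp add: norm_mult norm_minus_commute)
        also have "\<dots> \<le> (C - (\<Sum>k\<in>F. cmod (c k))) * cmod (g x)"
          using diff[OF F, of x] by (subst mult.commute) (intro mult_right_mono, auto)
        finally show "norm ((\<Sum>k\<in>F. c k * (g x * fchar L (k - n) x)) - g x * (G x * fchar L (- n) x))
          \<le> (C - (\<Sum>k\<in>F. cmod (c k))) * cmod (g x)" .
      qed (use ik iG g in auto)
      also have "\<dots> = (C - (\<Sum>k\<in>F. cmod (c k))) * I" by (simp add: I_def)
      finally show "norm ((\<Sum>k\<in>F. c k * fcoeff L g (n - k)) - fcoeff L (\<lambda>x. G x * g x) n) \<le> (C - (\<Sum>k\<in>F. cmod (c k))) * I" .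
    qed
  qed
qed

text \<open>
  By completeness \<open>f\<close> agrees almost everywhere with its Fourier series, which is then integrated
  against \<open>g\<close>.
\<close>
theorem fourier_series_product:
  assumes L: "L > 0" and f: "continuous_on UNIV f"
    and c: "(\<lambda>k. cmod (fcoeff L f k)) summable_on UNIV" and g: "integrable (lebesgue_on {0..L}) g"
  shows "((\<lambda>n. fcoeff L f (m - n) / of_real L * fcoeff L g n) has_sum fcoeff L (\<lambda>x. f x * g x) m) UNIV"
proof -
  define c where "c k = fcoeff L f k / of_real L" for k
  define G where "G x = (\<Sum>\<^sub>\<infinity>k. c k * fchar L k x)" for x
  have c: "(\<lambda>k. cmod (c k)) summable_on UNIV"
    using summable_on_cmult_left[OF c, of "inverse L"] L by (simp add: c_def norm_divide divide_inverse norm_mult norm_inverse)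
  have i1: "integrable (lebesgue_on {0..L}) (\<lambda>x. 1 :: complex)"
    by (intro continuous_integrable_period continuous_intros)
  have cG: "continuous_on UNIV G"
    using integral_fourier_series(1)[OF c i1] by (simp add: G_def[abs_def])
  have "fcoeff L G n = fcoeff L f n" for n
  proof -
    have "((\<lambda>k. c k * fcoeff L (\<lambda>x. 1) (n - k)) has_sum fcoeff L G n) UNIV"
      using integral_fourier_series(2)[OF c i1, of n] by (simp add: G_def[abs_def])
    moreover have "((\<lambda>k. c k * fcoeff L (\<lambda>x. 1) (n - k)) has_sum (c n * of_real L)) UNIV"
      by (rule has_sum_finite_neutralI[of "{n}"]) (auto simp: fcoeff_one[OF L])
    ultimately have "fcoeff L G n = c n * of_real L" by (rule has_sum_unique)
    then show ?thesis using L by (simp add: c_def)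
  qed
  then have "fcoeff L (\<lambda>x. f x - G x) n = 0" for n
  proof -
    have "fcoeff L (\<lambda>x. f x - G x) n = fcoeff L f n - fcoeff L G n"
      unfolding fcoeff_def left_diff_distrib
      by (rule Bochner_Integration.integral_diff)
        (intro integrable_mult_fchar continuous_integrable_period f cG)+
    then show ?thesis using \<open>\<And>n. fcoeff L G n = fcoeff L f n\<close> by simp
  qed
  then have ae: "AE x in lebesgue_on {0..L}. f x - G x = 0"
    by (intro fourier_complete[OF L] continuous_integrable_period continuous_intros f cG)
  have "fcoeff L (\<lambda>x. f x * g x) m = fcoeff L (\<lambda>x. G x * g x) m"
    unfolding fcoeff_def
  proof (rule integral_cong_AE)
    have m: "f \<in> borel_measurable (lebesgue_on {0..L})" "G \<in> borel_measurable (lebesgue_on {0..L})"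
      "fchar L (- m) \<in> borel_measurable (lebesgue_on {0..L})" "g \<in> borel_measurable (lebesgue_on {0..L})"
      using g by (auto intro!: continuous_on_imp_measurable_lebesgue_on f cG continuous_intros)
    show "(\<lambda>x. f x * g x * fchar L (- m) x) \<in> borel_measurable (lebesgue_on {0..L})"
      "(\<lambda>x. G x * g x * fchar L (- m) x) \<in> borel_measurable (lebesgue_on {0..L})"
      using m by measurable
    show "AE x in lebesgue_on {0..L}. f x * g x * fchar L (- m) x = G x * g x * fchar L (- m) x"
      using ae by eventually_elim simp
  qed
  moreover have "((\<lambda>k. c k * fcoeff L g (m - k)) has_sum fcoeff L (\<lambda>x. G x * g x) m) UNIV"
    using integral_fourier_series(2)[OF c g, of m] by (simp add: G_def[abs_def])
  moreover have "((\<lambda>k. c k * fcoeff L g (m - k)) has_sum S) UNIV \<longleftrightarrow>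
      ((\<lambda>n. c (m - n) * fcoeff L g n) has_sum S) UNIV" for S
    by (rule has_sum_reindex_bij_witness[where i = "\<lambda>n. m - n" and j = "\<lambda>n. m - n"]) auto
  ultimately show ?thesis by (simp add: c_def)
qed

section \<open>Periodic square-integrable functions\<close>

lemma L2_per_integrable:
  assumes "g \<in> L2_per L" shows "integrable (lebesgue_on {0..L}) g"
proof (rule Bochner_Integration.integrable_bound)
  have "integrable (lebesgue_on {0..L}) (\<lambda>x. 1 :: real)"
    using continuous_imp_integrable[of 0 L "\<lambda>x. 1 :: real"] by simp
  then show "integrable (lebesgue_on {0..L}) (\<lambda>x. 1 + (cmod (g x))\<^sup>2)"
    using assms by (intro Bochner_Integration.integrable_add) (auto simp: L2_per_def)
  show "g \<in> borel_measurable (lebesgue_on {0..L})" using assms by (simp add: L2_per_def)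
  have "t \<le> norm (1 + t\<^sup>2)" for t :: real
  proof -
    have "2 * t \<le> t\<^sup>2 + 1" "0 \<le> t\<^sup>2" using sum_squares_bound[of t 1] by simp_all
    then have "t \<le> 1 + t\<^sup>2" by linarith
    then show ?thesis unfolding real_norm_def by linarith
  qed
  then show "AE x in lebesgue_on {0..L}. cmod (g x) \<le> norm (1 + (cmod (g x))\<^sup>2)"
    by (intro AE_I2)
qed

lemma L2_per_continuous:
  assumes "continuous_on UNIV g" "periodic L g" shows "g \<in> L2_per L"
proof -
  have "continuous_on (cbox 0 L) (\<lambda>x. (cmod (g x))\<^sup>2)"
    by (intro continuous_intros continuous_on_subset[OF assms(1)]) auto
  then show ?thesis
    using assms continuous_imp_integrable[of 0 L "\<lambda>x. (cmod (g x))\<^sup>2"]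
    by (auto simp: L2_per_def intro: continuous_on_imp_measurable_lebesgue_on)
qed

lemma L2_per_add:
  assumes u: "u \<in> L2_per L" and w: "w \<in> L2_per L" shows "(\<lambda>x. u x + w x) \<in> L2_per L"
proof -
  have m: "u \<in> borel_measurable (lebesgue_on {0..L})" "w \<in> borel_measurable (lebesgue_on {0..L})"
    using u w by (auto simp: L2_per_def)
  have "integrable (lebesgue_on {0..L}) (\<lambda>x. (cmod (u x + w x))\<^sup>2)"
  proof (rule Bochner_Integration.integrable_bound)
    show "integrable (lebesgue_on {0..L}) (\<lambda>x. 2 * (cmod (u x))\<^sup>2 + 2 * (cmod (w x))\<^sup>2)"
      using u w by (auto simp: L2_per_def)
    show "(\<lambda>x. (cmod (u x + w x))\<^sup>2) \<in> borel_measurable (lebesgue_on {0..L})"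
      using m by measurable
    have "(cmod (a + b))\<^sup>2 \<le> 2 * (cmod a)\<^sup>2 + 2 * (cmod b)\<^sup>2" for a b
    proof -
      have "(cmod (a + b))\<^sup>2 \<le> (cmod a + cmod b)\<^sup>2"
        by (intro power_mono norm_triangle_ineq) simp
      also have "\<dots> \<le> 2 * (cmod a)\<^sup>2 + 2 * (cmod b)\<^sup>2"
        using sum_squares_bound[of "cmod a" "cmod b"] by (simp add: power2_sum)
      finally show ?thesis .
    qed
    then show "AE x in lebesgue_on {0..L}. norm ((cmod (u x + w x))\<^sup>2) \<le> norm (2 * (cmod (u x))\<^sup>2 + 2 * (cmod (w x))\<^sup>2)"
      by (intro AE_I2) simp
  qed
  then show ?thesis using u w m by (auto simp: L2_per_def periodic_def)
qed

lemma L2_per_mult: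
  assumes f: "continuous_on UNIV f" "periodic L f" and g: "g \<in> L2_per L"
  shows "(\<lambda>x. f x * g x) \<in> L2_per L"
proof -
  have mf: "f \<in> borel_measurable (lebesgue_on {0..L})"
    by (intro continuous_on_imp_measurable_lebesgue_on f)
  have mg: "g \<in> borel_measurable (lebesgue_on {0..L})" using g by (simp add: L2_per_def)
  have "compact (f ` {0..L})"
    by (intro compact_continuous_image continuous_on_subset[OF f(1)]) auto
  then obtain B where B: "\<And>x. x \<in> {0..L} \<Longrightarrow> cmod (f x) \<le> B"
    using compact_imp_bounded bounded_iff by (metis image_eqI)
  have "integrable (lebesgue_on {0..L}) (\<lambda>x. (cmod (f x * g x))\<^sup>2)"
  proof (rule Bochner_Integration.integrable_bound)
    show "integrable (lebesgue_on {0..L}) (\<lambda>x. B\<^sup>2 * (cmod (g x))\<^sup>2)"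
      using g by (auto simp: L2_per_def)
    show "(\<lambda>x. (cmod (f x * g x))\<^sup>2) \<in> borel_measurable (lebesgue_on {0..L})"
      using mf mg by measurable
    show "AE x in lebesgue_on {0..L}. norm ((cmod (f x * g x))\<^sup>2) \<le> norm (B\<^sup>2 * (cmod (g x))\<^sup>2)"
      using B by (intro AE_I2) (auto simp: norm_mult power_mult_distrib intro!: mult_right_mono power_mono)
  qed
  then show ?thesis using f g mf mg by (auto simp: L2_per_def periodic_def)
qed

lemma L2_per_sum:
  assumes "finite F" "\<And>j. j \<in> F \<Longrightarrow> u j \<in> L2_per L" shows "(\<lambda>x. \<Sum>j\<in>F. u j x) \<in> L2_per L"
  using assms
proof (induction F rule: finite_induct)
  case empty
  show ?case by (simp add: L2_per_continuous periodic_def)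
next
  case (insert j F)
  then have "(\<lambda>x. u j x + (\<Sum>j\<in>F. u j x)) \<in> L2_per L" by (intro L2_per_add) auto
  then show ?case using insert by simp
qed

lemma fcoeff_bound: "cmod (fcoeff L g n) \<le> integral\<^sup>L (lebesgue_on {0..L}) (\<lambda>x. cmod (g x))"
  unfolding fcoeff_def
  by (rule order_trans[OF integral_norm_bound]) (simp add: norm_mult)

lemma fcoeff_add:
  assumes "integrable (lebesgue_on {0..L}) u" "integrable (lebesgue_on {0..L}) w"
  shows "fcoeff L (\<lambda>x. u x + w x) n = fcoeff L u n + fcoeff L w n"
  unfolding fcoeff_def distrib_right
  by (rule Bochner_Integration.integral_add) (intro integrable_mult_fchar assms)+

lemma fcoeff_sum:
  assumes "\<And>j. j \<in> F \<Longrightarrow> integrable (lebesgue_on {0..L}) (u j)"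
  shows "fcoeff L (\<lambda>x. \<Sum>j\<in>F. u j x) n = (\<Sum>j\<in>F. fcoeff L (u j) n)"
  unfolding fcoeff_def sum_distrib_right
  by (rule Bochner_Integration.integral_sum) (intro integrable_mult_fchar assms)

lemma fcoeff_cong_AE:
  assumes "ae_eq L u w" "integrable (lebesgue_on {0..L}) u" "integrable (lebesgue_on {0..L}) w"
  shows "fcoeff L u n = fcoeff L w n"
  unfolding fcoeff_def
proof (rule integral_cong_AE)
  show "AE x in lebesgue_on {0..L}. u x * fchar L (- n) x = w x * fchar L (- n) x"
    using assms(1) unfolding ae_eq_def by eventually_elim simp
qed (intro borel_measurable_integrable integrable_mult_fchar assms)+

section \<open>The operator on Fourier coefficients\<close>

lemma wderiv_weak_deriv:
  assumes "u \<in> sobolev_per L p" "j \<le> p"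
  shows "wderiv L j u \<in> L2_per L" "weak_deriv L j u (wderiv L j u)"
proof -
  have "\<exists>g. g \<in> L2_per L \<and> weak_deriv L j u g" using assms by (auto simp: sobolev_per_def)
  then have "wderiv L j u \<in> L2_per L \<and> weak_deriv L j u (wderiv L j u)"
    unfolding wderiv_def by (rule someI_ex)
  then show "wderiv L j u \<in> L2_per L" "weak_deriv L j u (wderiv L j u)" by auto
qed

text \<open>
  The characters are admissible test functions for the weak derivative.
\<close>
lemma fcoeff_wderiv:
  assumes L: "L > 0" and u: "u \<in> sobolev_per L p" "j \<le> p"
  shows "fcoeff L (wderiv L j u) n = freq L n ^ j * fcoeff L u n"
proof -
  have "integral\<^sup>L (lebesgue_on {0..L}) (\<lambda>x. u x * nth_deriv j (fchar L (- n)) x) = (- 1) ^ j * fcoeff L (wderiv L j u) n"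
    unfolding fcoeff_def
    by (rule wderiv_weak_deriv(2)[OF u, unfolded weak_deriv_def, rule_format, OF conjI[OF smooth_fchar periodic_fchar[OF L]]])
  moreover have "(\<lambda>x. u x * nth_deriv j (fchar L (- n)) x) = (\<lambda>x. freq L (- n) ^ j * (u x * fchar L (- n) x))"
    unfolding nth_deriv_fchar by (simp only: mult.left_commute)
  moreover have "freq L (- n) ^ j = (- 1) ^ j * freq L n ^ j"
    unfolding freq_minus by (rule power_minus)
  ultimately have "(- 1) ^ j * (freq L n ^ j * fcoeff L u n) = (- 1) ^ j * fcoeff L (wderiv L j u) n"
    by (simp only: integral_mult_right_zero fcoeff_def mult.assoc)
  moreover have "(- 1 :: complex) ^ j \<noteq> 0" by simp
  ultimately show ?thesis by (metis mult_cancel_left)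
qed

lemma has_sum_finite_sum:
  fixes g :: "'i \<Rightarrow> 'k \<Rightarrow> 'a :: topological_comm_monoid_add"
  assumes "finite F" "\<And>j. j \<in> F \<Longrightarrow> (g j has_sum S j) A"
  shows "((\<lambda>k. \<Sum>j\<in>F. g j k) has_sum (\<Sum>j\<in>F. S j)) A"
  using assms by (induction F rule: finite_induct) (auto intro: has_sum_add)

text \<open>
  The matrix, in the basis \<open>fchar L n\<close>, of the terms of order below \<open>p\<close>.
\<close>
definition lower_symbol :: "real \<Rightarrow> nat \<Rightarrow> (nat \<Rightarrow> real \<Rightarrow> complex) \<Rightarrow> int \<Rightarrow> int \<Rightarrow> complex" where
  "lower_symbol L p f m n = (\<Sum>j<p. fcoeff L (f j) (m - n) / of_real L * freq L n ^ j)"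

definition fourier_matrix :: "real \<Rightarrow> nat \<Rightarrow> (nat \<Rightarrow> real \<Rightarrow> complex) \<Rightarrow> int \<Rightarrow> int \<Rightarrow> complex" where
  "fourier_matrix L p f m n = (if m = n then freq L n ^ p else 0) + lower_symbol L p f m n"

lemma hill_op_L2_per:
  assumes "\<And>j. j < p \<Longrightarrow> continuous_on UNIV (f j)" "\<And>j. j < p \<Longrightarrow> periodic L (f j)"
    and u: "u \<in> sobolev_per L p"
  shows "hill_op L p f u \<in> L2_per L"
  unfolding hill_op_def using assms
  by (intro L2_per_add L2_per_sum L2_per_mult wderiv_weak_deriv[OF u]) auto

theorem fcoeff_hill_op:
  assumes L: "L > 0" and f: "\<And>j. j < p \<Longrightarrow> continuous_on UNIV (f j)" "\<And>j. j < p \<Longrightarrow> periodic L (f j)"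
    and c: "\<And>j. j < p \<Longrightarrow> (\<lambda>k. cmod (fcoeff L (f j) k)) summable_on UNIV"
    and u: "u \<in> sobolev_per L p"
  shows "((\<lambda>n. lower_symbol L p f m n * fcoeff L u n) has_sum
           (fcoeff L (hill_op L p f u) m - freq L m ^ p * fcoeff L u m)) UNIV"
proof -
  note w = wderiv_weak_deriv(1)[OF u]
  have "fcoeff L (hill_op L p f u) m
    = fcoeff L (wderiv L p u) m + fcoeff L (\<lambda>x. \<Sum>j<p. f j x * wderiv L j u x) m"
    unfolding hill_op_def using f
    by (intro fcoeff_add L2_per_integrable w L2_per_sum L2_per_mult) auto
  also have "fcoeff L (\<lambda>x. \<Sum>j<p. f j x * wderiv L j u x) m = (\<Sum>j<p. fcoeff L (\<lambda>x. f j x * wderiv L j u x) m)"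
    using f by (intro fcoeff_sum L2_per_integrable w L2_per_mult) auto
  finally have "fcoeff L (hill_op L p f u) m - freq L m ^ p * fcoeff L u m
      = (\<Sum>j<p. fcoeff L (\<lambda>x. f j x * wderiv L j u x) m)"
    using fcoeff_wderiv[OF L u, of p m] by simp
  moreover have "((\<lambda>n. \<Sum>j<p. fcoeff L (f j) (m - n) / of_real L * (freq L n ^ j * fcoeff L u n)) has_sum
      (\<Sum>j<p. fcoeff L (\<lambda>x. f j x * wderiv L j u x) m)) UNIV"
  proof (rule has_sum_finite_sum)
    show "finite {..<p}" by simp
    fix j assume "j \<in> {..<p}"
    then have "j < p" "j \<le> p" by auto
    then show "((\<lambda>n. fcoeff L (f j) (m - n) / of_real L * (freq L n ^ j * fcoeff L u n)) has_sum
        fcoeff L (\<lambda>x. f j x * wderiv L j u x) m) UNIV"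
      using fourier_series_product[OF L f(1) c L2_per_integrable[OF w], of j j m] fcoeff_wderiv[OF L u, of j]
      by simp
  qed
  ultimately show ?thesis by (simp add: lower_symbol_def sum_distrib_right mult.assoc)
qed

lemma ae_eq_refl: "ae_eq L u u" by (simp add: ae_eq_def)

lemma selfadjoint_symmetric:
  assumes sa: "selfadjoint_op L D T" and T: "\<And>u. u \<in> D \<Longrightarrow> T u \<in> L2_per L" and D: "D \<subseteq> L2_per L"
    and "u \<in> D" "w \<in> D"
  shows "inner_L2 L (T u) w = inner_L2 L u (T w)"
proof -
  have "(\<forall>u\<in>D. inner_L2 L (T u) w = inner_L2 L u (T w)) \<longleftrightarrow> (w \<in> D \<and> ae_eq L (T w) (T w))"
    by (rule sa[unfolded selfadjoint_op_def, rule_format]) (use T D \<open>w \<in> D\<close> in auto)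
  then show ?thesis using \<open>u \<in> D\<close> \<open>w \<in> D\<close> ae_eq_refl[of L "T w"] by blast
qed

lemma inner_L2_commute: "inner_L2 L u w = cnj (inner_L2 L w u)"
  unfolding inner_L2_def by (subst Bochner_Integration.integral_cnj[symmetric]) (simp add: mult.commute)

section \<open>Trigonometric polynomials\<close>

definition trig :: "real \<Rightarrow> nat \<Rightarrow> (int \<Rightarrow> complex) \<Rightarrow> real \<Rightarrow> complex" where
  "trig L N c x = (\<Sum>n = - int N..int N. c n * fchar L n x)"

lemma trig_L2_per: "L > 0 \<Longrightarrow> trig L N c \<in> L2_per L"
  unfolding trig_def[abs_def] using periodic_fchar
  by (intro L2_per_continuous continuous_intros) (auto simp: periodic_def)

lemma trig_weak_deriv:
  assumes L: "L > 0"
  shows "weak_deriv L j (trig L N c) (trig L N (\<lambda>n. c n * freq L n ^ j))"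
  unfolding weak_deriv_def
proof (intro allI impI)
  fix \<psi> assume \<psi>: "smooth \<psi> \<and> periodic L \<psi>"
  have int: "integral\<^sup>L (lebesgue_on {0..L}) (\<lambda>x. trig L N c x * h x) = (\<Sum>n = - int N..int N. c n * fcoeff L h (- n))"
    if "continuous_on UNIV h" for h c
  proof -
    have "integral\<^sup>L (lebesgue_on {0..L}) (\<lambda>x. trig L N c x * h x)
      = integral\<^sup>L (lebesgue_on {0..L}) (\<lambda>x. \<Sum>n = - int N..int N. c n * (h x * fchar L n x))"
      unfolding trig_def sum_distrib_right by (simp only: mult_ac)
    also have "\<dots> = (\<Sum>n = - int N..int N. c n * fcoeff L h (- n))"
      unfolding fcoeff_def
      by (subst Bochner_Integration.integral_sum)
        (auto intro!: continuous_integrable_period continuous_intros that)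
    finally show ?thesis .
  qed
  have c\<psi>: "continuous_on UNIV (nth_deriv j \<psi>)" for j using \<psi> smooth_continuous by blast
  have "integral\<^sup>L (lebesgue_on {0..L}) (\<lambda>x. trig L N c x * nth_deriv j \<psi> x)
     = (\<Sum>n = - int N..int N. c n * (freq L (- n) ^ j * fcoeff L \<psi> (- n)))"
    using \<psi> by (simp add: int[OF c\<psi>] fcoeff_nth_deriv[OF L])
  also have "\<dots> = (- 1) ^ j * (\<Sum>n = - int N..int N. c n * freq L n ^ j * fcoeff L \<psi> (- n))"
    unfolding sum_distrib_left freq_minus
    by (intro sum.cong refl) (simp add: power_minus[of "freq L n" for n] mult_ac)
  also have "\<dots> = (- 1) ^ j * integral\<^sup>L (lebesgue_on {0..L}) (\<lambda>x. trig L N (\<lambda>n. c n * freq L n ^ j) x * \<psi> x)"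
    using int[OF c\<psi>[of 0]] by simp
  finally show "integral\<^sup>L (lebesgue_on {0..L}) (\<lambda>x. trig L N c x * nth_deriv j \<psi> x)
    = (- 1) ^ j * integral\<^sup>L (lebesgue_on {0..L}) (\<lambda>x. trig L N (\<lambda>n. c n * freq L n ^ j) x * \<psi> x)" .
qed

lemma trig_sobolev_per: "L > 0 \<Longrightarrow> trig L N c \<in> sobolev_per L p"
  unfolding sobolev_per_def using trig_L2_per trig_weak_deriv by blast

lemma fcoeff_trig:
  assumes L: "L > 0"
  shows "fcoeff L (trig L N c) k = (if k \<in> {- int N..int N} then of_real L * c k else 0)"
proof -
  have "fcoeff L (trig L N c) k = (\<Sum>n = - int N..int N. c n * (if k = n then of_real L else 0))"
    unfolding trig_def[abs_def]
    by (subst fcoeff_sum) (auto intro!: continuous_integrable_period continuous_intros simp: fcoeff_cmult fcoeff_fchar[OF L])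
  also have "\<dots> = (\<Sum>n = - int N..int N. if k = n then c n * of_real L else 0)"
    by (intro sum.cong) auto
  finally show ?thesis by (simp add: mult.commute)
qed

lemma fourier_trunc_trig: "L > 0 \<Longrightarrow> fourier_trunc L N u = trig L N (\<lambda>n. fcoeff L u n / of_real L)"
  by (rule ext) (simp add: fourier_trunc_eq trig_def)

lemma fourier_trunc_of_trig: "L > 0 \<Longrightarrow> fourier_trunc L N (trig L N c) = trig L N c"
  unfolding fourier_trunc_trig by (rule ext) (simp add: trig_def fcoeff_trig)

section \<open>Decay of the Fourier coefficients of smooth and analytic functions\<close>

lemma summable_on_int_abs:
  fixes g :: "nat \<Rightarrow> real"
  assumes "summable g" "\<And>k. 0 \<le> g k"
  shows "(\<lambda>k::int. g (nat \<bar>k\<bar>)) summable_on UNIV"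
proof -
  have g: "g summable_on UNIV" using assms by (simp add: summable_on_UNIV_nonneg_real_iff)
  have "(\<lambda>k::int. g (nat \<bar>k\<bar>)) summable_on range int"
    by (subst summable_on_reindex) (use g in \<open>auto simp: o_def\<close>)
  moreover have "(\<lambda>k::int. g (nat \<bar>k\<bar>)) summable_on range (\<lambda>n. - int n)"
    by (subst summable_on_reindex) (use g in \<open>auto simp: o_def inj_on_def\<close>)
  moreover have "(UNIV :: int set) = range int \<union> range (\<lambda>n. - int n)"
  proof -
    have "k \<in> range int \<union> range (\<lambda>n. - int n)" for k
    proof (cases "k \<ge> 0")
      case True
      then have "k = int (nat k)" by simp
      then show ?thesis by blast
    next
      case False
      then have "k = - int (nat (- k))" by simp
      then show ?thesis by blast
    qed
    then show ?thesis by blast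
  qed
  ultimately show ?thesis using summable_on_union by metis
qed

lemma fcoeff_smooth_decay:
  assumes L: "L > 0" and u: "smooth u" "periodic L u"
  shows "\<exists>M\<ge>0. \<forall>n. cmod (fcoeff L u n) * (1 + \<bar>real_of_int n\<bar>) ^ i \<le> M"
proof -
  define I where "I j = integral\<^sup>L (lebesgue_on {0..L}) (\<lambda>x. cmod (nth_deriv j u x))" for j
  define \<alpha> where "\<alpha> = 2 * pi / L"
  have \<alpha>: "\<alpha> > 0" using L by (simp add: \<alpha>_def)
  have bd: "(\<alpha> * \<bar>real_of_int n\<bar>) ^ j * cmod (fcoeff L u n) \<le> I j" for j n
    using fcoeff_bound[of L "nth_deriv j u" n] fcoeff_nth_deriv[OF L u, of j n] norm_freq[OF L, of n]
    by (simp add: I_def \<alpha>_def norm_mult norm_power)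
  have I0: "I j \<ge> 0" for j by (simp add: I_def)
  have main: "cmod (fcoeff L u n) * (1 + \<bar>real_of_int n\<bar>) ^ i \<le> I 0 + 2 ^ i * (I i / \<alpha> ^ i)" for n
  proof (cases "n = 0")
    case True
    have "0 \<le> 2 ^ i * (I i / \<alpha> ^ i)" using I0[of i] \<alpha> by simp
    then show ?thesis using bd[of n 0] True by simp
  next
    case False
    have "(1 + \<bar>real_of_int n\<bar>) ^ i \<le> (2 * \<bar>real_of_int n\<bar>) ^ i"
      using False by (intro power_mono) auto
    then have "cmod (fcoeff L u n) * (1 + \<bar>real_of_int n\<bar>) ^ i \<le> cmod (fcoeff L u n) * (2 * \<bar>real_of_int n\<bar>) ^ i"
      by (rule mult_left_mono) simp
    also have "\<dots> = 2 ^ i * ((\<alpha> * \<bar>real_of_int n\<bar>) ^ i * cmod (fcoeff L u n) / \<alpha> ^ i)"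
      using \<alpha> by (simp add: power_mult_distrib)
    also have "\<dots> \<le> 2 ^ i * (I i / \<alpha> ^ i)"
      using bd[of n i] \<alpha> by (intro mult_left_mono divide_right_mono) auto
    finally show ?thesis using I0[of 0] by linarith
  qed
  have "0 \<le> I 0 + 2 ^ i * (I i / \<alpha> ^ i)" using I0[of 0] I0[of i] \<alpha> by simp
  then show ?thesis using main by blast
qed

lemma smooth_weighted_summable:
  assumes L: "L > 0" and u: "smooth u" "periodic L u"
  shows "(\<lambda>k. cmod (fcoeff L u k) * (1 + real (nat \<bar>k\<bar>)) ^ s) summable_on UNIV"
proof -
  obtain M where M: "M \<ge> 0" "\<And>n. cmod (fcoeff L u n) * (1 + \<bar>real_of_int n\<bar>) ^ (s + 2) \<le> M"
    using fcoeff_smooth_decay[OF L u] by blast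
  have "summable (\<lambda>k. inverse (real (Suc k) ^ 2))"
    using inverse_power_summable[of 2, where 'a = real] summable_Suc_iff[of "\<lambda>k. inverse (real k ^ 2)"] by simp
  then have "summable (\<lambda>k. M * inverse ((1 + real k) ^ 2))"
    by (intro summable_mult) (simp add: add.commute)
  then have "(\<lambda>k::int. M * inverse ((1 + real (nat \<bar>k\<bar>)) ^ 2)) summable_on UNIV"
    by (rule summable_on_int_abs) (use M in auto)
  then show ?thesis
  proof (rule summable_on_comparison_test)
    fix k :: int
    have "cmod (fcoeff L u k) * (1 + real (nat \<bar>k\<bar>)) ^ s * (1 + real (nat \<bar>k\<bar>)) ^ 2 \<le> M"
      using M(2)[of k] by (simp add: power_add power2_eq_square mult_ac)
    moreover have "(1 + real (nat \<bar>k\<bar>)) ^ 2 > 0" by (intro zero_less_power) linarith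
    ultimately show "cmod (fcoeff L u k) * (1 + real (nat \<bar>k\<bar>)) ^ s \<le> M * inverse ((1 + real (nat \<bar>k\<bar>)) ^ 2)"
      by (simp add: divide_inverse[symmetric] pos_le_divide_eq)
  qed auto
qed

lemma strip_props: "convex {z. \<bar>Im z\<bar> < d}" "open {z. \<bar>Im z\<bar> < d}"
proof -
  have "{z. \<bar>Im z\<bar> < d} = {z. Im z < d} \<inter> {z. Im z > - d}" by auto
  then show "convex {z. \<bar>Im z\<bar> < d}" "open {z. \<bar>Im z\<bar> < d}"
    by (simp_all add: convex_Int convex_halfspace_Im_lt convex_halfspace_Im_gt open_Int open_halfspace_Im_lt open_halfspace_Im_gt)
qed

text \<open>
  Periodicity on the real line propagates to the strip by the identity theorem.
\<close>
lemma strip_extension_periodic: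
  assumes d: "d > 0" and G: "G holomorphic_on {z. \<bar>Im z\<bar> < d}"
    and per: "\<And>x. G (of_real (x + L)) = G (of_real x)" and z: "\<bar>Im z\<bar> < d"
  shows "G (z + of_real L) = G z"
proof -
  have "G (z + of_real L) - G z = 0"
  proof (rule analytic_continuation[where f = "\<lambda>z. G (z + of_real L) - G z" and S = "{z. \<bar>Im z\<bar> < d}" and U = "\<real>" and \<xi> = 0])
    show "(\<lambda>z. G (z + of_real L) - G z) holomorphic_on {z. \<bar>Im z\<bar> < d}"
      by (intro holomorphic_intros G holomorphic_on_compose_gen[OF _ G, unfolded o_def]) auto
    have "(\<lambda>n. complex_of_real (inverse (real (Suc n)))) \<longlonglongrightarrow> 0"
      using tendsto_of_real[OF LIMSEQ_inverse_real_of_nat, where 'a = complex] by (simp only: of_real_0)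
    moreover have "complex_of_real (inverse (real (Suc n))) \<in> \<real> - {0}" for n
      by (simp del: of_nat_Suc)
    ultimately show "0 islimpt (\<real> :: complex set)"
      unfolding islimpt_sequential by (intro exI[of _ "\<lambda>n. complex_of_real (inverse (real (Suc n)))"]) simp
    show "G (z + complex_of_real L) - G z = 0" if "z \<in> \<real>" for z
    proof -
      from that obtain x where "z = of_real x" by (auto elim: Reals_cases)
      then show ?thesis using per[of x] by simp
    qed
    show "connected {z. \<bar>Im z\<bar> < d}" by (rule convex_connected[OF strip_props(1)])
    show "\<real> \<subseteq> {z. \<bar>Im z\<bar> < d}" using d by (auto simp: complex_is_Real_iff)
    show "open {z. \<bar>Im z\<bar> < d}" by (rule strip_props)
  qed (use d z in auto)
  then show ?thesis by simp
qed

text \<open>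
  Let \<open>H\<close> be a primitive of \<open>Q\<close>. The integral over one period at height \<open>y\<close> is the increment
  of \<open>H\<close> over that period. This increment is constant on the strip, because its derivative is
  \<open>Q (z + L) - Q z = 0\<close>.
\<close>
lemma integral_shift_strip:
  assumes Q: "Q holomorphic_on {z. \<bar>Im z\<bar> < d}" and d: "d > 0" and L: "L > 0"
    and per: "\<And>z. \<bar>Im z\<bar> < d \<Longrightarrow> Q (z + of_real L) = Q z" and y: "\<bar>y\<bar> < d"
  shows "integral\<^sup>L (lebesgue_on {0..L}) (\<lambda>x. Q (of_real x + \<i> * of_real y)) = integral\<^sup>L (lebesgue_on {0..L}) (\<lambda>x. Q (of_real x))"
proof -
  let ?S = "{z. \<bar>Im z\<bar> < d}"
  obtain H where H': "\<And>z. z \<in> ?S \<Longrightarrow> (H has_field_derivative Q z) (at z within ?S)"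
    using holomorphic_convex_primitive'[OF strip_props Q] by blast
  have H: "(H has_field_derivative Q z) (at z)" if "z \<in> ?S" for z
    using H'[OF that] at_within_open[OF that strip_props(2)] by simp
  have "\<exists>c. \<forall>z\<in>?S. H (z + of_real L) - H z = c"
  proof (rule has_field_derivative_zero_constant[OF strip_props(1)])
    fix z assume z: "z \<in> ?S"
    have "((\<lambda>z. H (z + of_real L) - H z) has_field_derivative Q (z + of_real L) * 1 - Q z) (at z)"
      using z by (intro DERIV_diff DERIV_chain2[where f = H] H) (auto intro!: derivative_eq_intros)
    then have "((\<lambda>z. H (z + of_real L) - H z) has_field_derivative 0) (at z)"
      using per[of z] z by simp
    then show "((\<lambda>z. H (z + of_real L) - H z) has_field_derivative 0) (at z within ?S)"
      by (rule has_field_derivative_at_within)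
  qed
  then obtain c where c: "\<And>z. z \<in> ?S \<Longrightarrow> H (z + of_real L) - H z = c" by blast
  have main: "integral\<^sup>L (lebesgue_on {0..L}) (\<lambda>x. Q (of_real x + \<i> * of_real y)) = c" if y: "\<bar>y\<bar> < d" for y
  proof -
    let ?g = "\<lambda>x. of_real x + \<i> * of_real y :: complex"
    have gS: "?g x \<in> ?S" for x using y by simp
    have "continuous_on UNIV (\<lambda>x. Q (?g x))"
      by (intro continuous_on_compose2[OF holomorphic_on_imp_continuous_on[OF Q]] continuous_intros) (use gS in auto)
    then have "integral\<^sup>L (lebesgue_on {0..L}) (\<lambda>x. Q (?g x)) = integral {0..L} (\<lambda>x. Q (?g x))"
      by (intro lebesgue_integral_eq_integral continuous_integrable_period) auto
    also have "((\<lambda>x. Q (?g x)) has_integral (H (?g L) - H (?g 0))) {0..L}"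
    proof (rule fundamental_theorem_of_calculus)
      fix x :: real assume "x \<in> {0..L}"
      have "(?g has_vector_derivative 1) (at x within {0..L})"
        by (auto intro!: derivative_eq_intros)
      from field_vector_diff_chain_within[OF this has_field_derivative_at_within[OF H[OF gS]]]
      show "((\<lambda>x. H (?g x)) has_vector_derivative Q (?g x)) (at x within {0..L})"
        by (simp add: o_def)
    qed (use L in simp)
    then have "integral {0..L} (\<lambda>x. Q (?g x)) = H (?g L) - H (?g 0)" by (rule integral_unique)
    also have "\<dots> = c" using c[OF gS[of 0]] by (simp add: add.commute)
    finally show ?thesis .
  qed
  show ?thesis using main[OF y] main[of 0] d by simp
qed

text \<open>
  On the line \<open>Im z = y\<close> the character in the integral for the \<open>n\<close>-th coefficient has modulus
  \<open>exp (- 2 \<pi> n y / L)\<close>. Hence the contour is moved up for \<open>n \<ge> 0\<close> and down for \<open>n < 0\<close>.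
\<close>
lemma fcoeff_analytic_decay:
  assumes L: "L > 0" and an: "analytic_on_strip d u" and per: "periodic L u" and d': "0 < d'" "d' < d"
  shows "\<exists>M\<ge>0. \<forall>n. cmod (fcoeff L u n) \<le> M * exp (- (2 * pi * d' / L) * \<bar>real_of_int n\<bar>)"
proof -
  obtain G where G: "G holomorphic_on {z. \<bar>Im z\<bar> < d}" and Gu: "\<And>x. G (of_real x) = u x"
    using an by (auto simp: analytic_on_strip_def)
  have d: "d > 0" using d' by simp
  have Gper: "G (z + of_real L) = G z" if "\<bar>Im z\<bar> < d" for z
    by (rule strip_extension_periodic[OF d G _ that]) (use per in \<open>simp only: Gu periodic_def simp_thms\<close>)
  have cG: "continuous_on UNIV (\<lambda>x. G (of_real x + \<i> * of_real y))" if "\<bar>y\<bar> < d" for y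
    by (intro continuous_on_compose2[OF holomorphic_on_imp_continuous_on[OF G]] continuous_intros) (use that in auto)
  define I where "I y = integral\<^sup>L (lebesgue_on {0..L}) (\<lambda>x. cmod (G (of_real x + \<i> * of_real y)))" for y
  have I0: "I y \<ge> 0" for y by (simp add: I_def)
  have shift: "cmod (fcoeff L u n) \<le> exp (- (2 * pi * of_int n / L) * y) * I y" if y: "\<bar>y\<bar> < d" for n y
  proof -
    define Q where "Q z = G z * exp (freq L (- n) * z)" for z
    have Qh: "Q holomorphic_on {z. \<bar>Im z\<bar> < d}"
      unfolding Q_def by (intro holomorphic_intros G)
    have e1: "exp (freq L (- n) * of_real L) = 1"
      using periodic_fchar[OF L, of "- n"] unfolding periodic_def fchar_exp by (metis add_0 exp_zero mult_zero_right of_real_0)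
    have Qp: "Q (z + of_real L) = Q z" if "\<bar>Im z\<bar> < d" for z
      using Gper[OF that] e1 by (simp add: Q_def distrib_left exp_add)
    have "fcoeff L u n = integral\<^sup>L (lebesgue_on {0..L}) (\<lambda>x. Q (of_real x))"
      unfolding fcoeff_def Q_def Gu fchar_exp ..
    also have "\<dots> = integral\<^sup>L (lebesgue_on {0..L}) (\<lambda>x. Q (of_real x + \<i> * of_real y))"
      using integral_shift_strip[OF Qh d L Qp y] by simp
    also have "cmod \<dots> \<le> integral\<^sup>L (lebesgue_on {0..L}) (\<lambda>x. cmod (Q (of_real x + \<i> * of_real y)))"
      by (rule integral_norm_bound)
    also have "\<dots> = integral\<^sup>L (lebesgue_on {0..L}) (\<lambda>x. exp (- (2 * pi * of_int n / L) * y) * cmod (G (of_real x + \<i> * of_real y)))"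
    proof (intro Bochner_Integration.integral_cong refl)
      fix x
      have "Re (freq L (- n) * (of_real x + \<i> * of_real y)) = - (2 * pi * of_int n / L) * y"
        by (simp add: freq_def)
      then show "cmod (Q (of_real x + \<i> * of_real y)) = exp (- (2 * pi * of_int n / L) * y) * cmod (G (of_real x + \<i> * of_real y))"
        by (simp only: Q_def norm_mult norm_exp_eq_Re mult.commute)
    qed
    also have "\<dots> = exp (- (2 * pi * of_int n / L) * y) * I y"
      unfolding I_def by simp
    finally show ?thesis .
  qed
  show ?thesis
  proof (intro exI[of _ "I d' + I (- d')"] conjI allI)
    fix n
    show "cmod (fcoeff L u n) \<le> (I d' + I (- d')) * exp (- (2 * pi * d' / L) * \<bar>real_of_int n\<bar>)"
    proof (cases "n \<ge> 0")
      case True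
      have "cmod (fcoeff L u n) \<le> exp (- (2 * pi * of_int n / L) * d') * I d'"
        using d' by (intro shift) auto
      also have "\<dots> \<le> exp (- (2 * pi * of_int n / L) * d') * (I d' + I (- d'))"
        using I0 by (intro mult_left_mono) auto
      finally show ?thesis using True by (simp add: mult_ac)
    next
      case False
      have "cmod (fcoeff L u n) \<le> exp (- (2 * pi * of_int n / L) * (- d')) * I (- d')"
        using d' by (intro shift) auto
      also have "\<dots> \<le> exp (- (2 * pi * of_int n / L) * (- d')) * (I d' + I (- d'))"
        using I0 by (intro mult_left_mono) auto
      finally show ?thesis using False by (simp add: mult_ac)
    qed
  qed (use I0 in auto)
qed

text \<open>
  The coefficients decay at the rate belonging to \<open>d - e / 2\<close>, which beats the weight belonging
  to \<open>d - e\<close> by a geometric factor.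
\<close>
lemma analytic_weighted_summable:
  assumes L: "L > 0" and an: "analytic_on_strip d u" and per: "periodic L u" and e: "0 < e" "e < d"
  shows "(\<lambda>k. cmod (fcoeff L u k) * exp (2 * pi * (d - e) / L * real (nat \<bar>k\<bar>))) summable_on UNIV"
proof -
  define \<delta> where "\<delta> = pi * e / L"
  have \<delta>: "\<delta> > 0" using L e by (simp add: \<delta>_def)
  obtain M where M: "M \<ge> 0" "\<And>n. cmod (fcoeff L u n) \<le> M * exp (- (2 * pi * (d - e / 2) / L) * \<bar>real_of_int n\<bar>)"
    using fcoeff_analytic_decay[OF L an per, of "d - e / 2"] e by auto
  have "summable (\<lambda>k. M * exp (- \<delta>) ^ k)"
    using \<delta> by (intro summable_mult summable_geometric) simp
  then have "(\<lambda>k::int. M * exp (- \<delta>) ^ nat \<bar>k\<bar>) summable_on UNIV"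
    by (rule summable_on_int_abs) (use M in auto)
  then show ?thesis
  proof (rule summable_on_comparison_test)
    fix k :: int
    let ?t = "real (nat \<bar>k\<bar>)"
    have "cmod (fcoeff L u k) * exp (2 * pi * (d - e) / L * ?t)
      \<le> M * exp (- (2 * pi * (d - e / 2) / L) * ?t) * exp (2 * pi * (d - e) / L * ?t)"
      using M(2)[of k] by (intro mult_right_mono) auto
    also have "\<dots> = M * exp (- (2 * pi * (d - e / 2) / L) * ?t + 2 * pi * (d - e) / L * ?t)"
      by (simp only: exp_add mult.assoc)
    also have "- (2 * pi * (d - e / 2) / L) * ?t + 2 * pi * (d - e) / L * ?t = ?t * (- \<delta>)"
      using L by (simp add: \<delta>_def field_simps)
    also have "exp (?t * (- \<delta>)) = exp (- \<delta>) ^ nat \<bar>k\<bar>"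
      by (rule exp_of_nat_mult)
    finally show "cmod (fcoeff L u k) * exp (2 * pi * (d - e) / L * ?t) \<le> M * exp (- \<delta>) ^ nat \<bar>k\<bar>" .
  qed auto
qed

section \<open>Hermitian structure and the truncated spectrum\<close>

lemma selfadjoint_eigenvalue_real:
  assumes sa: "selfadjoint_op L D T" and T: "\<And>u. u \<in> D \<Longrightarrow> T u \<in> L2_per L" and D: "D \<subseteq> L2_per L"
    and e: "eigenvector_op L D T lam \<phi>"
  shows "lam = of_real (Re lam)"
proof -
  have \<phi>: "\<phi> \<in> D" "\<not> ae_eq L \<phi> (\<lambda>_. 0)" "ae_eq L (T \<phi>) (\<lambda>x. lam * \<phi> x)"
    using e by (auto simp: eigenvector_op_def)
  have m: "\<phi> \<in> borel_measurable (lebesgue_on {0..L})" "T \<phi> \<in> borel_measurable (lebesgue_on {0..L})"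
    using T[OF \<phi>(1)] D \<phi>(1) by (auto simp: L2_per_def)
  define Q where "Q = integral\<^sup>L (lebesgue_on {0..L}) (\<lambda>x. (cmod (\<phi> x))\<^sup>2)"
  have i: "integrable (lebesgue_on {0..L}) (\<lambda>x. (cmod (\<phi> x))\<^sup>2)" using D \<phi>(1) by (auto simp: L2_per_def)
  have "inner_L2 L (T \<phi>) \<phi> = integral\<^sup>L (lebesgue_on {0..L}) (\<lambda>x. lam * of_real ((cmod (\<phi> x))\<^sup>2))"
    unfolding inner_L2_def
  proof (rule integral_cong_AE)
    have "(\<lambda>x. cnj (\<phi> x)) \<in> borel_measurable (lebesgue_on {0..L})"
      by (rule measurable_compose[OF m(1) borel_measurable_continuous_onI]) (intro continuous_intros)
    then show "(\<lambda>x. T \<phi> x * cnj (\<phi> x)) \<in> borel_measurable (lebesgue_on {0..L})"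
      using m(2) by measurable
    show "(\<lambda>x. lam * complex_of_real ((cmod (\<phi> x))\<^sup>2)) \<in> borel_measurable (lebesgue_on {0..L})"
      using m(1) by measurable
    show "AE x in lebesgue_on {0..L}. T \<phi> x * cnj (\<phi> x) = lam * complex_of_real ((cmod (\<phi> x))\<^sup>2)"
      using \<phi>(3) unfolding ae_eq_def by eventually_elim (simp add: complex_norm_square del: of_real_power)
  qed
  also have "\<dots> = lam * of_real Q" unfolding Q_def by (simp del: of_real_power)
  finally have 1: "inner_L2 L (T \<phi>) \<phi> = lam * of_real Q" .
  have "inner_L2 L (T \<phi>) \<phi> = inner_L2 L \<phi> (T \<phi>)"
    by (rule selfadjoint_symmetric[OF sa T D \<phi>(1) \<phi>(1)])
  then have "lam * of_real Q = cnj lam * of_real Q"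
    using inner_L2_commute[of L \<phi> "T \<phi>"] 1 by simp
  moreover have "Q \<noteq> 0"
  proof
    assume "Q = 0"
    then have "AE x in lebesgue_on {0..L}. (cmod (\<phi> x))\<^sup>2 = 0"
      using integral_nonneg_eq_0_iff_AE[OF i] by (simp add: Q_def)
    then have "ae_eq L \<phi> (\<lambda>_. 0)" unfolding ae_eq_def by eventually_elim simp
    then show False using \<phi>(2) by simp
  qed
  ultimately have "lam = cnj lam" by simp
  then show ?thesis by (simp add: complex_eq_iff)
qed

text \<open>
  The entry at \<open>(m, n)\<close> is, up to the factor \<open>L\<close>, the inner product of the image of \<open>fchar L n\<close> with
  \<open>fchar L m\<close>, so symmetry of the operator carries over.
\<close>
lemma fourier_matrix_hermitian:
  assumes L: "L > 0" and f: "\<And>j. j < p \<Longrightarrow> continuous_on UNIV (f j)" "\<And>j. j < p \<Longrightarrow> periodic L (f j)"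
    and c: "\<And>j. j < p \<Longrightarrow> (\<lambda>k. cmod (fcoeff L (f j) k)) summable_on UNIV"
    and sa: "selfadjoint_op L (sobolev_per L p) (hill_op L p f)"
  shows "fourier_matrix L p f m n = cnj (fourier_matrix L p f n m)"
proof -
  \<comment> \<open>Any degree that covers both \<open>m\<close> and \<open>n\<close> will do.\<close>
  define N where "N = nat (\<bar>m\<bar> + \<bar>n\<bar>)"
  define E where "E k = trig L N (\<lambda>i. if i = k then 1 else 0)" for k :: int
  have E: "E k = fchar L k" if "k \<in> {m, n}" for k
  proof
    fix x
    have "E k x = (\<Sum>i = - int N..int N. if i = k then fchar L i x else 0)"
      unfolding E_def trig_def by (rule sum.cong) auto
    also have "\<dots> = fchar L k x" using that by (auto simp: N_def)
    finally show "E k x = fchar L k x" .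
  qed
  have inn: "inner_L2 L u (fchar L k) = fcoeff L u k" for u k
    by (simp add: inner_L2_def fcoeff_def cnj_fchar)
  have S: "fchar L k \<in> sobolev_per L p" if "k \<in> {m, n}" for k
    using E[OF that] trig_sobolev_per[OF L] unfolding E_def by metis
  have coeff: "fcoeff L (hill_op L p f (fchar L k)) l = of_real L * fourier_matrix L p f l k" if "k \<in> {m, n}" for k l
  proof -
    have "((\<lambda>i. lower_symbol L p f l i * fcoeff L (fchar L k) i) has_sum
        (fcoeff L (hill_op L p f (fchar L k)) l - freq L l ^ p * fcoeff L (fchar L k) l)) UNIV"
      by (rule fcoeff_hill_op[OF L f c S[OF that]])
    moreover have "((\<lambda>i. lower_symbol L p f l i * fcoeff L (fchar L k) i) has_sum (lower_symbol L p f l k * of_real L)) UNIV"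
      by (rule has_sum_finite_neutralI[of "{k}"]) (auto simp: fcoeff_fchar[OF L])
    ultimately have "fcoeff L (hill_op L p f (fchar L k)) l - freq L l ^ p * fcoeff L (fchar L k) l = lower_symbol L p f l k * of_real L"
      by (rule has_sum_unique)
    then show ?thesis by (auto simp: fourier_matrix_def fcoeff_fchar[OF L] algebra_simps)
  qed
  have D: "sobolev_per L p \<subseteq> L2_per L" by (auto simp: sobolev_per_def)
  have "inner_L2 L (hill_op L p f (fchar L n)) (fchar L m) = inner_L2 L (fchar L n) (hill_op L p f (fchar L m))"
    by (rule selfadjoint_symmetric[OF sa hill_op_L2_per[OF f] D S S]) auto
  also have "\<dots> = cnj (inner_L2 L (hill_op L p f (fchar L m)) (fchar L n))"
    by (rule inner_L2_commute)
  finally have "of_real L * fourier_matrix L p f m n = cnj (of_real L * fourier_matrix L p f n m)"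
    by (simp only: inn coeff insertI1 insertI2)
  then show ?thesis using L by simp
qed

lemma spectrum_truncI:
  assumes L: "L > 0" and f: "\<And>j. j < p \<Longrightarrow> continuous_on UNIV (f j)" "\<And>j. j < p \<Longrightarrow> periodic L (f j)"
    and c: "\<And>j. j < p \<Longrightarrow> (\<lambda>k. cmod (fcoeff L (f j) k)) summable_on UNIV"
    and nz: "\<exists>i\<in>{- int N..int N}. x i \<noteq> 0"
    and ev: "\<And>m. m \<in> {- int N..int N} \<Longrightarrow> (\<Sum>n = - int N..int N. fourier_matrix L p f m n * x n) = z * x m"
  shows "z \<in> spectrum_trunc L p f N"
  unfolding spectrum_trunc_def
proof (intro CollectI bexI conjI)
  let ?u = "trig L N x"
  show "?u \<in> fourier_trunc L N ` L2_per L"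
    using fourier_trunc_of_trig[OF L, of N x] trig_L2_per[OF L, of N x] by (metis imageI)
  show "?u \<noteq> (\<lambda>_. 0)"
  proof
    assume u0: "?u = (\<lambda>_. 0)"
    obtain i where "i \<in> {- int N..int N}" "x i \<noteq> 0" using nz by blast
    then show False using fcoeff_trig[OF L, of N x i] L unfolding u0 by (simp add: fcoeff_def)
  qed
  have "fcoeff L (hill_op L p f ?u) m / of_real L = z * x m" if m: "m \<in> {- int N..int N}" for m
  proof -
    have "((\<lambda>i. lower_symbol L p f m i * fcoeff L ?u i) has_sum
        (fcoeff L (hill_op L p f ?u) m - freq L m ^ p * fcoeff L ?u m)) UNIV"
      by (rule fcoeff_hill_op[OF L f c trig_sobolev_per[OF L]])
    moreover have "((\<lambda>i. lower_symbol L p f m i * fcoeff L ?u i) has_sum (\<Sum>i = - int N..int N. lower_symbol L p f m i * (of_real L * x i))) UNIV"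
      by (rule has_sum_finite_neutralI[of "{- int N..int N}"]) (auto simp: fcoeff_trig[OF L])
    ultimately have "fcoeff L (hill_op L p f ?u) m - freq L m ^ p * fcoeff L ?u m = (\<Sum>i = - int N..int N. lower_symbol L p f m i * (of_real L * x i))"
      by (rule has_sum_unique)
    then have "fcoeff L (hill_op L p f ?u) m = freq L m ^ p * (of_real L * x m) + (\<Sum>i = - int N..int N. lower_symbol L p f m i * (of_real L * x i))"
      using m by (simp add: fcoeff_trig[OF L] algebra_simps)
    also have "freq L m ^ p * (of_real L * x m) = (\<Sum>i = - int N..int N. if m = i then freq L i ^ p * (of_real L * x i) else 0)"
      using m by simp
    also have "\<dots> + (\<Sum>i = - int N..int N. lower_symbol L p f m i * (of_real L * x i)) = of_real L * (\<Sum>n = - int N..int N. fourier_matrix L p f m n * x n)"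
      unfolding sum.distrib[symmetric] sum_distrib_left
      by (intro sum.cong refl) (auto simp: fourier_matrix_def algebra_simps)
    finally show ?thesis using ev[OF m] L by simp
  qed
  then have "trig L N (\<lambda>m. fcoeff L (hill_op L p f ?u) m / of_real L) = (\<lambda>y. z * ?u y)"
    by (intro ext) (simp add: trig_def sum_distrib_left mult.assoc del: times_divide_eq_left)
  then show "hill_trunc L p f N ?u = (\<lambda>y. z * ?u y)"
    unfolding hill_trunc_def fourier_trunc_of_trig[OF L] by (simp only: fourier_trunc_trig[OF L, symmetric])
qed

section \<open>Convergence rate for weighted coefficients\<close>

text \<open>
  A submultiplicative weight \<open>v\<close> for which the weighted Fourier coefficients of all \<open>f j\<close> are
  summable. Powers of \<open>1 + k\<close> and exponentials are the two instances of interest, so that the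
  smooth and the analytic case share one proof.
\<close>
locale weighted_hill =
  fixes L :: real and p :: nat and f :: "nat \<Rightarrow> real \<Rightarrow> complex" and v :: "nat \<Rightarrow> real"
  assumes L: "L > 0" and p: "p \<ge> 1"
    and f_cont: "\<And>j. j < p \<Longrightarrow> continuous_on UNIV (f j)" and f_per: "\<And>j. j < p \<Longrightarrow> periodic L (f j)"
    and v1: "\<And>k. 1 \<le> v k" and v_mono: "\<And>i j. i \<le> j \<Longrightarrow> v i \<le> v j"
    and v_submult: "\<And>i j. v (i + j) \<le> v i * v j"
    and fv: "\<And>j. j < p \<Longrightarrow> (\<lambda>k. cmod (fcoeff L (f j) k) * v (nat \<bar>k\<bar>)) summable_on UNIV"
begin

definition coeff_sum :: "int \<Rightarrow> real" where
  "coeff_sum k = (\<Sum>j<p. cmod (fcoeff L (f j) k) / L)"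

text \<open>
  All derivatives of order below \<open>p\<close> enter the eigenvalue equation through products with the
  \<open>f j\<close>. Adding up the moduli of their Fourier coefficients gives a single sequence that is
  controlled by its own convolution with \<open>coeff_sum\<close>.
\<close>
definition deriv_amp :: "(real \<Rightarrow> complex) \<Rightarrow> int \<Rightarrow> real" where
  "deriv_amp u n = (\<Sum>j<p. cmod (freq L n) ^ j * cmod (fcoeff L u n))"

lemma coeff_sum_nonneg: "0 \<le> coeff_sum k"
  using L by (auto simp: coeff_sum_def intro!: sum_nonneg)

lemma deriv_amp_nonneg: "0 \<le> deriv_amp u n"
  by (auto simp: deriv_amp_def intro!: sum_nonneg)

lemma f_abs_summable: "j < p \<Longrightarrow> (\<lambda>k. cmod (fcoeff L (f j) k)) summable_on UNIV"
proof (rule summable_on_comparison_test[OF fv])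
  show "cmod (fcoeff L (f j) k) \<le> cmod (fcoeff L (f j) k) * v (nat \<bar>k\<bar>)" for k
    using mult_left_mono[OF v1, of "cmod (fcoeff L (f j) k)" "nat \<bar>k\<bar>"] by simp
qed simp_all

lemma coeff_sum_weighted_summable: "(\<lambda>k. coeff_sum k * v (nat \<bar>k\<bar>)) summable_on UNIV"
proof -
  have "((\<lambda>k. \<Sum>j<p. inverse L * (cmod (fcoeff L (f j) k) * v (nat \<bar>k\<bar>))) has_sum
      (\<Sum>j<p. \<Sum>\<^sub>\<infinity>k. inverse L * (cmod (fcoeff L (f j) k) * v (nat \<bar>k\<bar>)))) UNIV"
    by (rule has_sum_finite_sum, simp, rule has_sum_infsum, rule summable_on_cmult_right, rule fv) simp
  then have "(\<lambda>k. \<Sum>j<p. inverse L * (cmod (fcoeff L (f j) k) * v (nat \<bar>k\<bar>))) summable_on UNIV"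
    by (rule has_sum_imp_summable)
  moreover have "(\<Sum>j<p. inverse L * (cmod (fcoeff L (f j) k) * v (nat \<bar>k\<bar>))) = coeff_sum k * v (nat \<bar>k\<bar>)" for k
    unfolding coeff_sum_def sum_distrib_right by (rule sum.cong) (simp_all add: divide_inverse)
  ultimately show ?thesis by simp
qed

lemma coeff_sum_summable: "coeff_sum summable_on UNIV"
proof (rule summable_on_comparison_test[OF coeff_sum_weighted_summable])
  fix k
  show "coeff_sum k \<le> coeff_sum k * v (nat \<bar>k\<bar>)"
    using mult_left_mono[OF v1 coeff_sum_nonneg, of k "nat \<bar>k\<bar>"] by simp
qed (rule coeff_sum_nonneg)

lemma lower_symbol_bound: "cmod (lower_symbol L p f m n * fcoeff L u n) \<le> coeff_sum (m - n) * deriv_amp u n"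
proof -
  have "cmod (lower_symbol L p f m n * fcoeff L u n)
      \<le> (\<Sum>j<p. cmod (fcoeff L (f j) (m - n) / of_real L * freq L n ^ j * fcoeff L u n))"
    unfolding lower_symbol_def sum_distrib_right by (rule norm_sum)
  also have "\<dots> \<le> (\<Sum>j<p. cmod (fcoeff L (f j) (m - n)) / L * deriv_amp u n)"
  proof (rule sum_mono)
    fix j assume j: "j \<in> {..<p}"
    have "cmod (freq L n) ^ j * cmod (fcoeff L u n) \<le> deriv_amp u n"
      unfolding deriv_amp_def by (rule member_le_sum[OF j]) auto
    then have "cmod (fcoeff L (f j) (m - n)) / L * (cmod (freq L n) ^ j * cmod (fcoeff L u n)) \<le> cmod (fcoeff L (f j) (m - n)) / L * deriv_amp u n"
      using L by (intro mult_left_mono) auto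
    then show "cmod (fcoeff L (f j) (m - n) / of_real L * freq L n ^ j * fcoeff L u n) \<le> cmod (fcoeff L (f j) (m - n)) / L * deriv_amp u n"
      using L by (simp add: norm_mult norm_divide norm_power mult.assoc)
  qed
  also have "\<dots> = coeff_sum (m - n) * deriv_amp u n" by (simp add: coeff_sum_def sum_distrib_right)
  finally show ?thesis .
qed

lemma deriv_amp_bounded:
  assumes u: "u \<in> sobolev_per L p"
  shows "\<exists>A. \<forall>n. deriv_amp u n \<le> A"
proof (intro exI allI)
  fix n
  have "deriv_amp u n = (\<Sum>j<p. cmod (fcoeff L (wderiv L j u) n))"
    unfolding deriv_amp_def
    by (intro sum.cong refl) (simp add: fcoeff_wderiv[OF L u] norm_mult norm_power)
  also have "\<dots> \<le> (\<Sum>j<p. integral\<^sup>L (lebesgue_on {0..L}) (\<lambda>x. cmod (wderiv L j u x)))"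
    by (intro sum_mono fcoeff_bound)
  finally show "deriv_amp u n \<le> (\<Sum>j<p. integral\<^sup>L (lebesgue_on {0..L}) (\<lambda>x. cmod (wderiv L j u x)))" .
qed

lemma coeff_sum_shift_has_sum: "((\<lambda>m. coeff_sum (n - m)) has_sum infsum coeff_sum UNIV) UNIV"
proof -
  have "(coeff_sum has_sum infsum coeff_sum UNIV) UNIV" using coeff_sum_summable by simp
  then show ?thesis
    by (subst has_sum_reindex_bij_witness[where i = "\<lambda>m. n - m" and j = "\<lambda>m. n - m" and h = coeff_sum]) auto
qed

context
  fixes \<phi> :: "real \<Rightarrow> complex" and lam :: complex
  assumes eig: "eigenvector_op L (sobolev_per L p) (hill_op L p f) lam \<phi>"
begin

lemma eig_sobolev: "\<phi> \<in> sobolev_per L p"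
  using eig by (simp add: eigenvector_op_def)

lemma eig_has_sum:
  "((\<lambda>n. lower_symbol L p f m n * fcoeff L \<phi> n) has_sum (lam * fcoeff L \<phi> m - freq L m ^ p * fcoeff L \<phi> m)) UNIV"
proof -
  have L2: "hill_op L p f \<phi> \<in> L2_per L" by (rule hill_op_L2_per[OF f_cont f_per eig_sobolev])
  have "\<phi> \<in> L2_per L" using eig_sobolev by (simp add: sobolev_per_def)
  then have "integrable (lebesgue_on {0..L}) (\<lambda>x. lam * \<phi> x)"
    by (intro integrable_mult_right L2_per_integrable)
  then have "fcoeff L (hill_op L p f \<phi>) m = lam * fcoeff L \<phi> m"
    using fcoeff_cong_AE[of L "hill_op L p f \<phi>" "\<lambda>x. lam * \<phi> x" m] eig L2_per_integrable[OF L2]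
    by (simp add: eigenvector_op_def fcoeff_cmult)
  moreover have "((\<lambda>n. lower_symbol L p f m n * fcoeff L \<phi> n) has_sum
      (fcoeff L (hill_op L p f \<phi>) m - freq L m ^ p * fcoeff L \<phi> m)) UNIV"
    by (rule fcoeff_hill_op[OF L f_cont f_per f_abs_summable eig_sobolev])
  ultimately show ?thesis by simp
qed

text \<open>
  Multiplying \<open>deriv_amp \<phi> n\<close> by \<open>|freq L n|\<close> raises the order of each derivative by one. Orders
  below \<open>p\<close> stay within \<open>deriv_amp \<phi> n\<close>, and order \<open>p\<close> is expressed by the eigenvalue equation
  through \<open>\<lambda> \<phi>\<close> and a convolution with \<open>deriv_amp \<phi>\<close>.
\<close>
theorem eigenvector_decay: "\<exists>D. \<forall>n. deriv_amp \<phi> n * v (nat \<bar>n\<bar>) \<le> D"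
proof -
  obtain A where A: "\<And>n. deriv_amp \<phi> n \<le> A" using deriv_amp_bounded[OF eig_sobolev] by blast
  show ?thesis
  proof (rule convolution_bootstrap[OF deriv_amp_nonneg A coeff_sum_nonneg v1 v_mono v_submult coeff_sum_weighted_summable])
    show "2 * pi / L > 0" using L by simp
    fix n
    define K where "K = cmod (freq L n)"
    define x where "x = cmod (fcoeff L \<phi> n)"
    have "0 < p" using p by simp
    have x: "x \<le> deriv_amp \<phi> n"
      unfolding deriv_amp_def x_def using member_le_sum[of 0 "{..<p}" "\<lambda>j. cmod (freq L n) ^ j * cmod (fcoeff L \<phi> n)"] \<open>0 < p\<close> by simp
    have "K * deriv_amp \<phi> n = (\<Sum>j<p. K ^ Suc j * x)"
      by (simp add: deriv_amp_def K_def x_def sum_distrib_left mult.assoc)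
    also have "\<dots> \<le> (\<Sum>j<Suc p. K ^ j * x)"
      unfolding sum.lessThan_Suc_shift by (simp add: x_def)
    also have "\<dots> = deriv_amp \<phi> n + K ^ p * x" by (simp add: deriv_amp_def K_def x_def)
    finally have 1: "K * deriv_amp \<phi> n \<le> deriv_amp \<phi> n + K ^ p * x" .
    define R where "R = lam * fcoeff L \<phi> n - freq L n ^ p * fcoeff L \<phi> n"
    have sm: "(\<lambda>m. coeff_sum (n - m) * deriv_amp \<phi> m) summable_on UNIV"
    proof (rule summable_on_comparison_test)
      show "(\<lambda>m. coeff_sum (n - m) * A) summable_on UNIV"
        by (rule summable_on_cmult_left[OF has_sum_imp_summable[OF coeff_sum_shift_has_sum]])
      show "coeff_sum (n - m) * deriv_amp \<phi> m \<le> coeff_sum (n - m) * A" for m by (rule mult_left_mono[OF A coeff_sum_nonneg])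
      show "0 \<le> coeff_sum (n - m) * deriv_amp \<phi> m" for m by (rule mult_nonneg_nonneg[OF coeff_sum_nonneg deriv_amp_nonneg])
    qed
    have R: "cmod R \<le> (\<Sum>\<^sub>\<infinity>m. coeff_sum (n - m) * deriv_amp \<phi> m)"
      using norm_infsum_le[OF eig_has_sum[of n] has_sum_infsum[OF sm] lower_symbol_bound] by (simp add: R_def)
    have "K ^ p * x = cmod (lam * fcoeff L \<phi> n - R)"
      by (simp add: R_def K_def x_def norm_mult norm_power)
    also have "\<dots> \<le> cmod lam * x + cmod R"
      by (rule order_trans[OF norm_triangle_ineq4]) (simp add: x_def norm_mult)
    also have "\<dots> \<le> cmod lam * deriv_amp \<phi> n + (\<Sum>\<^sub>\<infinity>m. coeff_sum (n - m) * deriv_amp \<phi> m)"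
      using x R by (intro add_mono mult_left_mono) auto
    finally have "K * deriv_amp \<phi> n \<le> (1 + cmod lam) * deriv_amp \<phi> n + (\<Sum>\<^sub>\<infinity>m. coeff_sum (n - m) * deriv_amp \<phi> m)"
      using 1 by (simp add: distrib_right)
    then show "2 * pi / L * \<bar>real_of_int n\<bar> * deriv_amp \<phi> n \<le> (1 + cmod lam) * deriv_amp \<phi> n + (\<Sum>\<^sub>\<infinity>m. coeff_sum (n - m) * deriv_amp \<phi> m)"
      unfolding K_def norm_freq[OF L] .
  qed
qed

text \<open>
  The infinite system holds exactly, so the block over \<open>{-N..N}\<close> misses only the modes beyond
  \<open>N\<close>. There \<open>deriv_amp \<phi> n\<close> is at most a constant over \<open>v N\<close>.
\<close>
theorem galerkin_residual:
  "\<exists>D>0. \<forall>N. \<forall>m\<in>{- int N..int N}.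
     cmod ((\<Sum>n = - int N..int N. fourier_matrix L p f m n * fcoeff L \<phi> n) - lam * fcoeff L \<phi> m) \<le> D / v N"
proof -
  obtain D0 where D0: "\<And>n. deriv_amp \<phi> n * v (nat \<bar>n\<bar>) \<le> D0" using eigenvector_decay by blast
  have vp: "v k > 0" for k using v1[of k] by linarith
  define B where "B = infsum coeff_sum UNIV"
  have B: "B \<ge> 0" unfolding B_def by (intro infsum_nonneg coeff_sum_nonneg)
  have D0p: "D0 \<ge> 0" using order_trans[OF mult_nonneg_nonneg[OF deriv_amp_nonneg less_imp_le[OF vp]] D0] .
  have "cmod ((\<Sum>n = - int N..int N. fourier_matrix L p f m n * fcoeff L \<phi> n) - lam * fcoeff L \<phi> m) \<le> (B * D0 + 1) / v N"
    if m: "m \<in> {- int N..int N}" for N m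
  proof -
    let ?S = "{- int N..int N}"
    let ?s = "\<Sum>n\<in>?S. lower_symbol L p f m n * fcoeff L \<phi> n"
    have "(\<Sum>n\<in>?S. fourier_matrix L p f m n * fcoeff L \<phi> n) = (\<Sum>n\<in>?S. if m = n then freq L n ^ p * fcoeff L \<phi> n else 0) + ?s"
      unfolding sum.distrib[symmetric] by (intro sum.cong refl) (auto simp: fourier_matrix_def distrib_right)
    also have "(\<Sum>n\<in>?S. if m = n then freq L n ^ p * fcoeff L \<phi> n else 0) = freq L m ^ p * fcoeff L \<phi> m"
      using m by simp
    finally have eq: "(\<Sum>n\<in>?S. fourier_matrix L p f m n * fcoeff L \<phi> n) - lam * fcoeff L \<phi> m
       = - (lam * fcoeff L \<phi> m - freq L m ^ p * fcoeff L \<phi> m - ?s)" by simp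
    have 1: "((\<lambda>n. lower_symbol L p f m n * fcoeff L \<phi> n) has_sum (lam * fcoeff L \<phi> m - freq L m ^ p * fcoeff L \<phi> m - ?s)) (UNIV - ?S)"
      by (intro has_sum_Diff[OF eig_has_sum has_sum_finite]) auto
    have sb: "(\<lambda>n. coeff_sum (m - n)) summable_on (UNIV - ?S)"
      by (rule summable_on_subset[OF has_sum_imp_summable[OF coeff_sum_shift_has_sum]]) auto
    have 2: "((\<lambda>n. coeff_sum (m - n) * (D0 / v N)) has_sum (infsum (\<lambda>n. coeff_sum (m - n)) (UNIV - ?S) * (D0 / v N))) (UNIV - ?S)"
      by (intro has_sum_cmult_left has_sum_infsum sb)
    have le: "cmod (lower_symbol L p f m n * fcoeff L \<phi> n) \<le> coeff_sum (m - n) * (D0 / v N)" if n: "n \<in> UNIV - ?S" for n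
    proof -
      have "v N \<le> v (nat \<bar>n\<bar>)" using n by (intro v_mono) auto
      then have "deriv_amp \<phi> n * v N \<le> deriv_amp \<phi> n * v (nat \<bar>n\<bar>)" by (rule mult_left_mono[OF _ deriv_amp_nonneg])
      then have "deriv_amp \<phi> n * v N \<le> D0" using D0[of n] by linarith
      then have "deriv_amp \<phi> n \<le> D0 / v N" using vp[of N] by (simp add: pos_le_divide_eq)
      then show ?thesis by (intro order_trans[OF lower_symbol_bound] mult_left_mono coeff_sum_nonneg)
    qed
    have "cmod (lam * fcoeff L \<phi> m - freq L m ^ p * fcoeff L \<phi> m - ?s) \<le> infsum (\<lambda>n. coeff_sum (m - n)) (UNIV - ?S) * (D0 / v N)"
      by (rule norm_infsum_le[OF 1 2 le])
    also have "\<dots> \<le> B * (D0 / v N)"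
    proof (rule mult_right_mono)
      have "infsum (\<lambda>n. coeff_sum (m - n)) (UNIV - ?S) \<le> infsum (\<lambda>n. coeff_sum (m - n)) UNIV"
        by (rule infsum_mono2[OF sb has_sum_imp_summable[OF coeff_sum_shift_has_sum]]) (use coeff_sum_nonneg in auto)
      then show "infsum (\<lambda>n. coeff_sum (m - n)) (UNIV - ?S) \<le> B"
        using infsumI[OF coeff_sum_shift_has_sum] by (simp add: B_def)
      show "0 \<le> D0 / v N" using D0p vp[of N] by simp
    qed
    also have "\<dots> \<le> (B * D0 + 1) / v N" using vp[of N] by (simp add: divide_right_mono)
    finally show ?thesis unfolding eq norm_minus_cancel .
  qed
  moreover have "B * D0 + 1 > 0" using mult_nonneg_nonneg[OF B D0p] by linarith
  ultimately show ?thesis by (intro exI[of _ "B * D0 + 1"] conjI allI ballI)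
qed

text \<open>
  The factor \<open>sqrt (2 N + 1)\<close> passes from the bound on each of the \<open>2 N + 1\<close> entries of the
  residual to its Euclidean norm. The norm of the truncated coefficient vector is at least the
  modulus of one fixed nonzero coefficient \<open>x n0\<close>.
\<close>
theorem galerkin_eigenvalue_rate:
  assumes sa: "selfadjoint_op L (sobolev_per L p) (hill_op L p f)" and r: "r > 0"
  shows "\<exists>C>0. \<forall>lamN N0. separated_approximation L p f lam r lamN N0 \<longrightarrow>
           (\<forall>\<^sub>F N in sequentially. cmod (lam - lamN N) \<le> C * (sqrt (2 * real N + 1) / v N))"
proof -
  have vp: "v k > 0" for k using v1[of k] by linarith
  have D: "sobolev_per L p \<subseteq> L2_per L" by (auto simp: sobolev_per_def)
  define x where "x = fcoeff L \<phi>"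
  define l where "l = Re lam"
  have l: "lam = of_real l"
    unfolding l_def by (rule selfadjoint_eigenvalue_real[OF sa hill_op_L2_per[OF f_cont f_per] D eig])
  obtain n0 where n0: "x n0 \<noteq> 0"
  proof (rule ccontr)
    assume "\<not> thesis"
    then have "fcoeff L \<phi> n = 0" for n using that unfolding x_def by blast
    then have "ae_eq L \<phi> (\<lambda>_. 0)"
      unfolding ae_eq_def using D eig_sobolev by (intro fourier_complete[OF L] L2_per_integrable) auto
    then show False using eig by (simp add: eigenvector_op_def)
  qed
  obtain D where D: "D > 0" and res: "\<And>N m. m \<in> {- int N..int N} \<Longrightarrow>
      cmod ((\<Sum>n = - int N..int N. fourier_matrix L p f m n * x n) - lam * x m) \<le> D / v N"
    using galerkin_residual unfolding x_def by blast
  define C where "C = D / cmod (x n0)"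
  have near: "cmod (lam - lamN N) \<le> C * (sqrt (2 * real N + 1) / v N)"
    if sep: "separated_approximation L p f lam r lamN N0" and N: "N > N0" "N \<ge> nat \<bar>n0\<bar>" for lamN N0 N
  proof -
    let ?S = "{- int N..int N}"
    define H where "H m n = fourier_matrix L p f m n - (if m = n then lam else 0)" for m n
    have S: "finite ?S" "?S \<noteq> {}" by auto
    have Hx: "(\<Sum>n\<in>?S. H m n * y n) = (\<Sum>n\<in>?S. fourier_matrix L p f m n * y n) - lam * y m" if "m \<in> ?S" for m y
    proof -
      have "(\<Sum>n\<in>?S. H m n * y n) = (\<Sum>n\<in>?S. fourier_matrix L p f m n * y n - (if m = n then lam * y n else 0))"
        by (intro sum.cong refl) (auto simp: H_def left_diff_distrib)
      also have "\<dots> = (\<Sum>n\<in>?S. fourier_matrix L p f m n * y n) - lam * y m"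
        using that unfolding sum_subtractf by simp
      finally show ?thesis .
    qed
    have herm: "H m n = cnj (H n m)" for m n
    proof -
      have "fourier_matrix L p f m n = cnj (fourier_matrix L p f n m)"
        by (rule fourier_matrix_hermitian[OF L f_cont f_per f_abs_summable sa])
      moreover have "(if m = n then lam else 0) = cnj (if n = m then lam else 0)" by (simp add: l)
      ultimately show ?thesis
        unfolding H_def complex_cnj_diff by (rule arg_cong2[where f = minus])
    qed
    obtain c \<nu> where c: "\<exists>i\<in>?S. c i \<noteq> 0" "\<And>i. i \<in> ?S \<Longrightarrow> (\<Sum>j\<in>?S. H i j * c j) = of_real \<nu> * c i"
      and \<nu>: "\<And>y. \<nu>\<^sup>2 * (\<Sum>i\<in>?S. (cmod (y i))\<^sup>2) \<le> (\<Sum>i\<in>?S. (cmod (\<Sum>j\<in>?S. H i j * y j))\<^sup>2)"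
    proof (rule hermitian_eigenvalue_bound[where H = H, OF S])
      show "H i j = cnj (H j i)" for i j by (rule herm)
    qed (rule that)
    have "lam + of_real \<nu> \<in> spectrum_trunc L p f N"
    proof (rule spectrum_truncI[OF L f_cont f_per f_abs_summable c(1)])
      fix m assume "m \<in> ?S"
      then have "(\<Sum>n\<in>?S. fourier_matrix L p f m n * c n) - lam * c m = of_real \<nu> * c m"
        using c(2)[of m] Hx[of m c] by simp
      then show "(\<Sum>n\<in>?S. fourier_matrix L p f m n * c n) = (lam + of_real \<nu>) * c m"
        by (simp add: distrib_right diff_eq_eq add.commute)
    qed
    \<comment> \<open>An eigenvalue \<open>lam + \<nu>\<close> other than \<open>lamN N\<close> is at least \<open>2 r\<close> away from \<open>lam\<close>,
      farther than \<open>lamN N\<close>.\<close>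
    have le_\<nu>: "cmod (lam - lamN N) \<le> \<bar>\<nu>\<bar>"
    proof (cases "lamN N = lam + of_real \<nu>")
      case True
      then show ?thesis by simp
    next
      case False
      have sepN: "cmod (lam - lamN N) \<le> r / 2"
        "ereal (2 * r) \<le> edist_set lam (spectrum_trunc L p f N - {lamN N})"
        using sep N(1) by (auto simp: separated_approximation_def)
      have "edist_set lam (spectrum_trunc L p f N - {lamN N}) \<le> ereal (cmod (lam - (lam + of_real \<nu>)))"
        unfolding edist_set_def by (rule INF_lower) (use \<open>lam + of_real \<nu> \<in> _\<close> False in auto)
      also have "cmod (lam - (lam + of_real \<nu>)) = \<bar>\<nu>\<bar>" by simp
      finally have "ereal (2 * r) \<le> ereal \<bar>\<nu>\<bar>" using sepN(2) order_trans by blast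
      then have "2 * r \<le> \<bar>\<nu>\<bar>" by simp
      then show ?thesis using sepN(1) r by linarith
    qed
    have n0S: "n0 \<in> ?S" using N(2) by auto
    have "(\<bar>\<nu>\<bar> * cmod (x n0))\<^sup>2 \<le> \<nu>\<^sup>2 * (\<Sum>i\<in>?S. (cmod (x i))\<^sup>2)"
      using member_le_sum[OF n0S, of "\<lambda>i. (cmod (x i))\<^sup>2"] by (simp add: power_mult_distrib mult_left_mono)
    also have "\<dots> \<le> (\<Sum>i\<in>?S. (cmod (\<Sum>j\<in>?S. H i j * x j))\<^sup>2)" by (rule \<nu>)
    also have "\<dots> \<le> (\<Sum>i\<in>?S. (D / v N)\<^sup>2)"
      by (intro sum_mono power_mono) (use res Hx in auto)
    also have "\<dots> = (sqrt (2 * real N + 1) * (D / v N))\<^sup>2"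
      by (simp add: power_mult_distrib power_divide)
    finally have "\<bar>\<nu>\<bar> * cmod (x n0) \<le> sqrt (2 * real N + 1) * (D / v N)"
      by (rule power2_le_imp_le) (use D vp[of N] in auto)
    then have "\<bar>\<nu>\<bar> \<le> sqrt (2 * real N + 1) * (D / v N) / cmod (x n0)"
      using n0 by (subst pos_le_divide_eq) auto
    also have "\<dots> = C * (sqrt (2 * real N + 1) / v N)" by (simp add: C_def mult_ac)
    finally have "\<bar>\<nu>\<bar> \<le> C * (sqrt (2 * real N + 1) / v N)" .
    then show ?thesis using le_\<nu> by linarith
  qed
  have "C > 0" using D n0 by (simp add: C_def)
  moreover have "\<forall>\<^sub>F N in sequentially. cmod (lam - lamN N) \<le> C * (sqrt (2 * real N + 1) / v N)"
    if "separated_approximation L p f lam r lamN N0" for lamN N0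
    by (rule eventually_sequentiallyI[of "max (Suc N0) (nat \<bar>n0\<bar>)"]) (intro near[OF that], auto)
  ultimately show ?thesis by (intro exI[of _ C] conjI allI impI)
qed

end
end

section \<open>Exponential and superpolynomial convergence\<close>

lemma analytic_on_strip_continuous:
  assumes "analytic_on_strip d u" "d > 0"
  shows "continuous_on UNIV u"
proof -
  obtain G where G: "G holomorphic_on {z. \<bar>Im z\<bar> < d}" "\<And>x. G (of_real x) = u x"
    using assms(1) by (auto simp: analytic_on_strip_def)
  have "continuous_on UNIV (\<lambda>x. G (of_real x))"
    by (intro continuous_on_compose2[OF holomorphic_on_imp_continuous_on[OF G(1)]] continuous_intros)
      (use assms(2) in auto)
  then show ?thesis by (simp only: G(2))
qed

lemma weighted_hill_smooth:
  assumes "L > 0" "p \<ge> 1" "\<And>j. j < p \<Longrightarrow> smooth (f j)" "\<And>j. j < p \<Longrightarrow> periodic L (f j)"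
  shows "weighted_hill L p f (\<lambda>k. (1 + real k) ^ s)"
proof
  show "continuous_on UNIV (f j)" if "j < p" for j
    using smooth_continuous[OF assms(3)[OF that], of UNIV 0] by simp
  show "(\<lambda>k. cmod (fcoeff L (f j) k) * (1 + real (nat \<bar>k\<bar>)) ^ s) summable_on UNIV" if "j < p" for j
    by (rule smooth_weighted_summable[OF assms(1) assms(3)[OF that] assms(4)[OF that]])
  show "(1 + real (i + j)) ^ s \<le> (1 + real i) ^ s * (1 + real j) ^ s" for i j
    unfolding power_mult_distrib[symmetric] by (rule power_mono) (simp_all add: algebra_simps)
  show "1 \<le> (1 + real k) ^ s" for k by (rule one_le_power) simp
  show "(1 + real i) ^ s \<le> (1 + real j) ^ s" if "i \<le> j" for i j
    using that by (intro power_mono) auto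
qed (use assms in auto)

lemma weighted_hill_analytic:
  assumes "L > 0" "p \<ge> 1" "\<And>j. j < p \<Longrightarrow> analytic_on_strip d (f j)" "\<And>j. j < p \<Longrightarrow> periodic L (f j)"
    and e: "0 < e" "e < d"
  shows "weighted_hill L p f (\<lambda>k. exp (2 * pi * (d - e) / L * real k))"
proof
  show "continuous_on UNIV (f j)" if "j < p" for j
    using analytic_on_strip_continuous[OF assms(3)[OF that]] e by simp
  show "(\<lambda>k. cmod (fcoeff L (f j) k) * exp (2 * pi * (d - e) / L * real (nat \<bar>k\<bar>))) summable_on UNIV" if "j < p" for j
    by (rule analytic_weighted_summable[OF assms(1) assms(3)[OF that] assms(4)[OF that] e])
  have s: "2 * pi * (d - e) / L \<ge> 0" using assms(1) e by simp
  show "exp (2 * pi * (d - e) / L * real (i + j)) \<le> exp (2 * pi * (d - e) / L * real i) * exp (2 * pi * (d - e) / L * real j)" for i j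
    by (simp only: of_nat_add distrib_left exp_add order_refl)
  show "1 \<le> exp (2 * pi * (d - e) / L * real k)" for k
    using mult_nonneg_nonneg[OF s, of "real k"] by (simp only: one_le_exp_iff of_nat_0_le_iff simp_thms)
  show "exp (2 * pi * (d - e) / L * real i) \<le> exp (2 * pi * (d - e) / L * real j)" if "i \<le> j" for i j
    unfolding exp_le_cancel_iff using that s by (intro mult_left_mono) auto
qed (use assms in auto)

text \<open>
  In the smooth case the weight \<open>(1 + k)^(q + 1)\<close> has one power to spare for \<open>sqrt (2 N + 1)\<close>. In the
  analytic case that factor is absorbed into \<open>N powr (p + 1/2)\<close>.
\<close>
theorem theorem3p4:
  fixes p :: nat and L \<mu> r :: real and lam :: complex
    and ft f :: "nat \<Rightarrow> real \<Rightarrow> complex" and \<phi> :: "real \<Rightarrow> complex"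
  assumes "p \<ge> 1" and "L > 0"
    and "\<And>j. j < p \<Longrightarrow> smooth (ft j) \<and> periodic L (ft j)"
    and "0 \<le> \<mu>" and "\<mu> < 2 * pi / L"
    and "conjugated_coeffs p \<mu> ft f"
    and "\<And>j. j < p \<Longrightarrow> periodic L (f j)"
    and "selfadjoint_op L (sobolev_per L p) (hill_op L p f)"
    and "lam \<in> spectrum_hill L p f"
    and "r > 0"
    and "eigenvector_op L (sobolev_per L p) (hill_op L p f) lam \<phi>"
  shows
    "((\<forall>j<p. smooth (f j)) \<longrightarrow>
       (\<forall>q::nat. q \<ge> 1 \<longrightarrow>
          (\<exists>C1>0. \<forall>lamN N0. separated_approximation L p f lam r lamN N0 \<longrightarrow>
             (\<forall>\<^sub>F N in sequentially. cmod (lam - lamN N) \<le> C1 * real N powr (- real q)))))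
     \<and>
     (\<forall>d>0. (\<forall>j<p. analytic_on_strip d (f j)) \<longrightarrow>
       (\<forall>\<epsilon>. 0 < \<epsilon> \<and> \<epsilon> < d \<longrightarrow>
          (\<exists>C2>0. \<forall>lamN N0. separated_approximation L p f lam r lamN N0 \<longrightarrow>
             (\<forall>\<^sub>F N in sequentially.
                cmod (lam - lamN N) \<le>
                  C2 * real N powr (real p + 1 / 2) * exp (- (2 * pi * (d - \<epsilon>) / L) * real N)))))"
proof (intro conjI allI impI)
  note L = \<open>L > 0\<close> and p = \<open>p \<ge> 1\<close>
  note eig = assms(11) and sa = assms(8) and r = assms(10) and per = assms(7)
  {
    fix q :: nat
    assume sm: "\<forall>j<p. smooth (f j)" and "q \<ge> 1"
    have W: "weighted_hill L p f (\<lambda>k. (1 + real k) ^ (q + 1))"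
      by (rule weighted_hill_smooth[OF L p]) (simp_all add: sm per)
    obtain C where C: "C > 0 \<and> (\<forall>lamN N0. separated_approximation L p f lam r lamN N0 \<longrightarrow>
        (\<forall>\<^sub>F N in sequentially. cmod (lam - lamN N) \<le> C * (sqrt (2 * real N + 1) / (1 + real N) ^ (q + 1))))"
      by (rule exE[OF weighted_hill.galerkin_eigenvalue_rate[OF W eig sa r]])
    have bnd: "C * (sqrt (2 * real N + 1) / (1 + real N) ^ (q + 1)) \<le> 2 * C * real N powr (- real q)" if N: "N \<ge> 1" for N
    proof -
      have "sqrt (2 * real N + 1) \<le> 2 * (1 + real N)"
        by (rule real_le_lsqrt) (auto simp: power2_eq_square algebra_simps)
      then have "sqrt (2 * real N + 1) / (1 + real N) ^ (q + 1) \<le> 2 * (1 + real N) / (1 + real N) ^ (q + 1)"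
        by (rule divide_right_mono) simp
      also have "\<dots> = 2 / (1 + real N) ^ q"
        unfolding power_add power_one_right by (rule mult_divide_mult_cancel_right) linarith
      also have "\<dots> \<le> 2 / real N ^ q"
        using N by (intro divide_left_mono power_mono) auto
      also have "\<dots> = 2 * real N powr (- real q)"
        using N by (simp add: powr_minus powr_realpow divide_inverse)
      finally have "C * (sqrt (2 * real N + 1) / (1 + real N) ^ (q + 1)) \<le> C * (2 * real N powr (- real q))"
        using C[THEN conjunct1] by (intro mult_left_mono) auto
      then show ?thesis by (simp only: mult.assoc mult.left_commute)
    qed
    show "\<exists>C1>0. \<forall>lamN N0. separated_approximation L p f lam r lamN N0 \<longrightarrow>
        (\<forall>\<^sub>F N in sequentially. cmod (lam - lamN N) \<le> C1 * real N powr (- real q))"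
    proof (intro exI[of _ "2 * C"] conjI allI impI)
      fix lamN N0
      assume "separated_approximation L p f lam r lamN N0"
      from C[THEN conjunct2, rule_format, OF this] eventually_ge_at_top[of 1]
      show "\<forall>\<^sub>F N in sequentially. cmod (lam - lamN N) \<le> 2 * C * real N powr (- real q)"
        by eventually_elim (rule order_trans[OF _ bnd])
    qed (use C in auto)
  }
  {
    fix d \<epsilon> :: real
    assume "0 < d" and an: "\<forall>j<p. analytic_on_strip d (f j)" and \<epsilon>: "0 < \<epsilon> \<and> \<epsilon> < d"
    let ?s = "2 * pi * (d - \<epsilon>) / L"
    have W: "weighted_hill L p f (\<lambda>k. exp (?s * real k))"
      by (rule weighted_hill_analytic[OF L p]) (simp_all add: an per \<epsilon>)
    obtain C where C: "C > 0 \<and> (\<forall>lamN N0. separated_approximation L p f lam r lamN N0 \<longrightarrow>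
        (\<forall>\<^sub>F N in sequentially. cmod (lam - lamN N) \<le> C * (sqrt (2 * real N + 1) / exp (?s * real N))))"
      by (rule exE[OF weighted_hill.galerkin_eigenvalue_rate[OF W eig sa r]])
    have bnd: "C * (sqrt (2 * real N + 1) / exp (?s * real N)) \<le> 2 * C * real N powr (real p + 1 / 2) * exp (- ?s * real N)" if N: "N \<ge> 1" for N
    proof -
      have "sqrt (2 * real N + 1) \<le> sqrt (2\<^sup>2 * real N)" using N by simp
      also have "\<dots> = 2 * real N powr (1 / 2)" using N by (simp add: real_sqrt_mult powr_half_sqrt)
      also have "\<dots> \<le> 2 * real N powr (real p + 1 / 2)" using N by (intro mult_left_mono powr_mono) auto
      finally have "C * (sqrt (2 * real N + 1) * exp (- ?s * real N)) \<le> C * (2 * real N powr (real p + 1 / 2) * exp (- ?s * real N))"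
        using C[THEN conjunct1] by (intro mult_left_mono mult_right_mono) auto
      moreover have "exp (- ?s * real N) = inverse (exp (?s * real N))"
        unfolding minus_mult_left[symmetric] by (rule exp_minus)
      ultimately show ?thesis by (simp only: divide_inverse mult.assoc mult.left_commute)
    qed
    show "\<exists>C2>0. \<forall>lamN N0. separated_approximation L p f lam r lamN N0 \<longrightarrow>
        (\<forall>\<^sub>F N in sequentially. cmod (lam - lamN N) \<le> C2 * real N powr (real p + 1 / 2) * exp (- (2 * pi * (d - \<epsilon>) / L) * real N))"
    proof (intro exI[of _ "2 * C"] conjI allI impI)
      fix lamN N0
      assume "separated_approximation L p f lam r lamN N0"
      from C[THEN conjunct2, rule_format, OF this] eventually_ge_at_top[of 1]
      show "\<forall>\<^sub>F N in sequentially. cmod (lam - lamN N) \<le> 2 * C * real N powr (real p + 1 / 2) * exp (- (2 * pi * (d - \<epsilon>) / L) * real N)"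
        by eventually_elim (rule order_trans[OF _ bnd])
    qed (use C in auto)
  }
qed

end
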